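(* For all integers $n\ge m\ge1$ one has $G_{n,m}(t)=(t+1)^{n-m}G_m(t)$, where $G_m(t):=G_{m,m}(t)$. Moreover the polynomials $G_m(t)$ satisfy the formal power series identity $$\sum_{m=1}^\infty(-1)^{m-1}G_m(t)\left(\frac{z^2}{t+1}\right)^m=\frac{z\coth z+tz^2-1}{2(tz\coth z+1)}.$$
   Context: Let $W_n=S_n\ltimes\{\pm1\}^n$ act on $\mathbb{R}^n$ by permuting and sign-changing coordinates. For $j,m\ge1$ let $H_m^{(j)}(t_1,\dots,t_j)=\sum_{m_1+\cdots+m_j=m,\ m_i\ge0}t_1^{m_1}\cdots t_j^{m_j}$. For $k=0,\dots,n$ put $h_m^{(k)}(x)=H_m^{(k+1)}(s_1,\dots,s_{k+1})$ with $s_i=x_i+\cdots+x_n$ ($1\le i\le n$), $s_{n+1}=0$, and $\tau_m^{(k)}(x)=\frac{1}{2^nn!}\sum_{\sigma\in W_n}h_m^{(k)}(\sigma x)$. Let $e_{2j}(x)$ denote the $j$-th elementary symmetric polynomial of $x_1^2,\dots,x_n^2$. For $1\le m\le n$ and $0\le k\le n$, $c_{n,m}^{(k)}$ is the unique constant such that $\tau_{2m}^{(k)}(x)=c_{n,m}^{(k)}e_{2m}(x)+P(e_2(x),\dots,e_{2m-2}(x))$ for some polynomial $P$. Define $G_{n,m}(t)=\sum_{k=0}^n\frac{n!\,c_{n,m}^{(k)}}{(n-k)!\,(2m+k)!}t^{n-k}$. *)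

theory Defs
  imports
    "HOL-Library.FuncSet"
    "HOL-Library.Poly_Mapping"
    "HOL-Combinatorics.Permutations"
    "HOL-Computational_Algebra.Computational_Algebra"
begin

text \<open>
  A point of \<open>\<real>\<^sup>n\<close> is a function \<open>x :: nat \<Rightarrow> real\<close> read at the indices \<open>1, \<dots>, n\<close> only; all
  functions of \<open>x\<close> below ignore its other values.
\<close>

section \<open>The hyperoctahedral group\<close>

definition hyperoctahedral :: "nat \<Rightarrow> ((nat \<Rightarrow> nat) \<times> (nat \<Rightarrow> real)) set" where
  "hyperoctahedral n = {\<pi>. \<pi> permutes {1..n}} \<times> ({1..n} \<rightarrow>\<^sub>E {-1, 1})"

text \<open>Using the inverse permutation makes this a left action.\<close>

definition hyperoctahedral_act ::
  "(nat \<Rightarrow> nat) \<times> (nat \<Rightarrow> real) \<Rightarrow> (nat \<Rightarrow> real) \<Rightarrow> nat \<Rightarrow> real" where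
  "hyperoctahedral_act \<sigma> x i = snd \<sigma> i * x (inv (fst \<sigma>) i)"

section \<open>Symmetric functions of tail sums and their averages\<close>

text \<open>
  The complete homogeneous symmetric polynomial of degree \<open>m\<close> in \<open>t 1, \<dots>, t j\<close>. The bound
  \<open>\<mu> i \<le> m\<close> is implied by the sum condition.
\<close>

definition complete_homogeneous :: "nat \<Rightarrow> nat \<Rightarrow> (nat \<Rightarrow> real) \<Rightarrow> real" where
  "complete_homogeneous m j t =
     (\<Sum>\<mu> | \<mu> \<in> {1..j} \<rightarrow>\<^sub>E {0..m} \<and> (\<Sum>i=1..j. \<mu> i) = m. \<Prod>i=1..j. t i ^ \<mu> i)"

text \<open>In particular \<open>tail_sum n x (n + 1) = 0\<close>.\<close>

definition tail_sum :: "nat \<Rightarrow> (nat \<Rightarrow> real) \<Rightarrow> nat \<Rightarrow> real" where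
  "tail_sum n x i = (\<Sum>l=i..n. x l)"

definition h_tail :: "nat \<Rightarrow> nat \<Rightarrow> nat \<Rightarrow> (nat \<Rightarrow> real) \<Rightarrow> real" where
  "h_tail n m k x = complete_homogeneous m (k + 1) (tail_sum n x)"

definition tau :: "nat \<Rightarrow> nat \<Rightarrow> nat \<Rightarrow> (nat \<Rightarrow> real) \<Rightarrow> real" where
  "tau n m k x =
     1 / (2 ^ n * fact n) * (\<Sum>\<sigma>\<in>hyperoctahedral n. h_tail n m k (hyperoctahedral_act \<sigma> x))"

section \<open>The constants and the generating polynomials\<close>

text \<open>\<open>elem_sym_sq n j\<close> is \<open>e\<^sub>2\<^sub>j\<close>, of degree \<open>2 * j\<close> in \<open>x\<close>.\<close>

definition elem_sym_sq :: "nat \<Rightarrow> nat \<Rightarrow> (nat \<Rightarrow> real) \<Rightarrow> real" where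
  "elem_sym_sq n j x = (\<Sum>S | S \<subseteq> {1..n} \<and> card S = j. \<Prod>i\<in>S. (x i)\<^sup>2)"

text \<open>
  Multivariate real polynomials in variables indexed by \<open>nat\<close> are finitely supported maps from
  monomials (finitely supported exponent vectors) to coefficients.
\<close>

type_synonym real_mpoly = "(nat \<Rightarrow>\<^sub>0 nat) \<Rightarrow>\<^sub>0 real"

definition mpoly_vars :: "real_mpoly \<Rightarrow> nat set" where
  "mpoly_vars P = (\<Union>\<mu>\<in>Poly_Mapping.keys P. Poly_Mapping.keys \<mu>)"

definition mpoly_eval :: "real_mpoly \<Rightarrow> (nat \<Rightarrow> real) \<Rightarrow> real" where
  "mpoly_eval P v =
     (\<Sum>\<mu>\<in>Poly_Mapping.keys P.
        Poly_Mapping.lookup P \<mu> * (\<Prod>i\<in>Poly_Mapping.keys \<mu>. v i ^ Poly_Mapping.lookup \<mu> i))"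

text \<open>
  The variable \<open>i\<close> of \<open>P\<close> stands for \<open>e\<^sub>2\<^sub>i\<close>. An equality of values at all real points is an equality
  of polynomials in \<open>x\<close>.
\<close>

definition c_const :: "nat \<Rightarrow> nat \<Rightarrow> nat \<Rightarrow> real" where
  "c_const n m k =
     (THE c. \<exists>P. mpoly_vars P \<subseteq> {1..<m} \<and>
        (\<forall>x. tau n (2 * m) k x =
               c * elem_sym_sq n m x + mpoly_eval P (\<lambda>i. elem_sym_sq n i x)))"

definition G_poly :: "nat \<Rightarrow> nat \<Rightarrow> real poly" where
  "G_poly n m =
     (\<Sum>k=0..n. monom (fact n * c_const n m k / (fact (n - k) * fact (2 * m + k))) (n - k))"

section \<open>The hyperbolic cotangent as a formal series\<close>

definition fps_cosh :: "'a::field_char_0 fps" where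
  "fps_cosh = (fps_exp 1 + fps_exp (-1)) / 2"

definition fps_sinh :: "'a::field_char_0 fps" where
  "fps_sinh = (fps_exp 1 - fps_exp (-1)) / 2"

text \<open>
  The cotangent itself has a simple pole, but \<open>z coth z\<close> is a power series. Both \<open>z cosh z\<close> and
  \<open>sinh z\<close> have subdegree 1, so the division below is exact.
\<close>

definition fps_X_coth :: "'a::field_char_0 fps" where
  "fps_X_coth = fps_X * fps_cosh / fps_sinh"

end

theory Submission
  imports Defs "HOL-Combinatorics.Multiset_Permutations"
begin

text \<open>
  The series \<open>\<Sum>\<^sub>m h\<^sub>m\<^sup>(\<^sup>k\<^sup>) z\<^sup>m\<^sup>+\<^sup>k / (m + k)!\<close>, where \<open>s\<^sub>1\<close> is the same for all orderings of the variables,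
  satisfies \<open>y' = s\<^sub>1 y + \<dots>\<close> with the corresponding series for \<open>k - 1\<close> and one variable fewer
  as inhomogeneity. Summed over all orderings it therefore equals \<open>(n - k)!\<close> times the sum over
  the \<open>k\<close>-subsets \<open>K\<close> of \<open>\<Prod>\<^sub>j\<^sub>\<in>\<^sub>K (exp (x\<^sub>j z) - 1) / x\<^sub>j \<cdot> \<Prod>\<^sub>j\<^sub>\<notin>\<^sub>K exp (x\<^sub>j z)\<close>. Averaging over the signs and
  summing over \<open>k\<close>, \<open>\<Sum>\<^sub>k n! / (n - k)! t\<^sup>n\<^sup>-\<^sup>k \<tau>\<^sub>2\<^sub>m\<^sup>(\<^sup>k\<^sup>) / (2 m + k)!\<close> is the coefficient of \<open>z\<^sup>2\<^sup>m\<close> in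
  \<open>\<Prod>\<^sub>j F (x\<^sub>j z)\<close>, where \<open>F (z) = sinh z / z + t cosh z\<close>.

  Taking logarithms, the coefficient of \<open>e\<^sub>2\<^sub>m\<close> in it is \<open>(1 + t)\<^sup>n (-1)\<^sup>m\<^sup>-\<^sup>1\<close> times the coefficient
  of \<open>y\<^sup>m\<close> in the logarithmic derivative \<open>y E' / E\<close>, where \<open>F (z) = E (z\<^sup>2)\<close>. This holds for every
  real \<open>t > 0\<close> and so is an identity of polynomials in \<open>t\<close>. Both claims follow, the second one
  because \<open>y E' / E\<close> at \<open>y = z\<^sup>2\<close> is \<open>z F' / (2 F)\<close>.
\<close>

section \<open>Sums over orderings\<close>

text \<open>The series \<open>1 / (1 - a X)\<close>. Products of these generate the complete
  homogeneous polynomials.\<close>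

definition fps_geom :: "'a::field_char_0 \<Rightarrow> 'a fps" where
  "fps_geom a = Abs_fps (\<lambda>r. a ^ r)"

text \<open>The series \<open>(exp (a X) - 1) / (a X)\<close>, given by its coefficients so that
  \<open>a = 0\<close> needs no separate case.\<close>

definition fps_exp_quot :: "'a::field_char_0 \<Rightarrow> 'a fps" where
  "fps_exp_quot a = Abs_fps (\<lambda>r. a ^ r / fact (Suc r))"

lemma fps_geom_mult: "fps_geom a * f = fps_const a * fps_X * (fps_geom a * f) + f"
proof -
  have "fps_geom a = fps_const a * fps_X * fps_geom a + 1"
  proof (rule fps_ext)
    fix n show "fps_geom a $ n = (fps_const a * fps_X * fps_geom a + 1) $ n"
      by (cases n) (simp_all add: fps_geom_def mult.assoc)
  qed
  from arg_cong[OF this, of "\<lambda>g. g * f"] show ?thesis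
    by (simp only: distrib_right mult.assoc mult_1)
qed

lemma fps_exp_conv_quot: "fps_exp a = 1 + fps_const a * (fps_X * fps_exp_quot a)"
proof (rule fps_ext)
  fix n show "fps_exp a $ n = (1 + fps_const a * (fps_X * fps_exp_quot a)) $ n"
    by (cases n) (simp_all add: fps_exp_quot_def del: fact_Suc)
qed

lemma fps_deriv_X_exp_quot: "fps_deriv (fps_X * fps_exp_quot a) = fps_exp a"
proof (rule fps_ext)
  fix n
  have "of_nat (Suc n) * (a ^ n / fact (Suc n)) = a ^ n / fact n"
    by (simp add: field_simps del: of_nat_Suc)
  then show "fps_deriv (fps_X * fps_exp_quot a) $ n = fps_exp a $ n"
    by (simp add: fps_exp_quot_def distrib_right add_divide_distrib add_ac del: fact_Suc)
qed

text \<open>The equation at index \<open>n\<close> fixes coefficient \<open>Suc n\<close>, because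
  \<open>Suc n\<close> is invertible in characteristic zero.\<close>

lemma fps_linear_ode_unique:
  fixes f g :: "'a::field_char_0 fps"
  assumes "fps_deriv f = fps_const a * f + h" "fps_deriv g = fps_const a * g + h" "f $ 0 = g $ 0"
  shows "f = g"
proof (rule fps_ext)
  fix n show "f $ n = g $ n"
  proof (induction n)
    case (Suc n)
    have "fps_deriv f $ n = fps_deriv g $ n"
      unfolding assms(1,2) using Suc by simp
    then show ?case by (simp del: of_nat_Suc)
  qed (use assms in simp)
qed

lemma fps_deriv_prod:
  fixes f :: "'b \<Rightarrow> 'a::comm_ring_1 fps"
  assumes "finite A"
  shows "fps_deriv (prod f A) = (\<Sum>a\<in>A. fps_deriv (f a) * prod f (A - {a}))"
  using assms
proof (induction A rule: finite_induct)
  case (insert b A)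
  have "(\<Sum>a\<in>A. fps_deriv (f a) * prod f (insert b A - {a}))
      = (\<Sum>a\<in>A. fps_deriv (f a) * prod f (A - {a})) * f b"
    unfolding sum_distrib_right
  proof (rule sum.cong)
    fix a assume "a \<in> A"
    then have "insert b A - {a} = insert b (A - {a})" using insert by auto
    then show "fps_deriv (f a) * prod f (insert b A - {a}) = fps_deriv (f a) * prod f (A - {a}) * f b"
      using insert by (simp add: mult_ac)
  qed auto
  then show ?case using insert by (simp add: algebra_simps)
qed auto

lemma fps_const_sum: "fps_const (sum f A) = (\<Sum>a\<in>A. fps_const (f a))"
  by (induction A rule: infinite_finite_induct) (simp_all flip: fps_const_add)

lemma fps_const_fact: "fps_const (fact n) = fact n"
  by (metis fps_of_nat of_nat_fact)

section \<open>Tail sums along an ordering and their differential equation\<close>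

definition tail_geom :: "('b \<Rightarrow> 'a::field_char_0) \<Rightarrow> nat \<Rightarrow> 'b list \<Rightarrow> 'a fps" where
  "tail_geom x k l = (\<Prod>i\<le>k. fps_geom (sum_list (map x (drop i l))))"

text \<open>Coefficient \<open>m\<close> of \<open>tail_geom\<close> becomes the coefficient of
  \<open>z^(m+k) / (m+k)!\<close>. These are the factorials in \<open>G_poly\<close>, and the shift
  by \<open>k\<close> makes differentiation lower \<open>k\<close> by one.\<close>

definition tail_borel :: "('b \<Rightarrow> 'a::field_char_0) \<Rightarrow> nat \<Rightarrow> 'b list \<Rightarrow> 'a fps" where
  "tail_borel x k l = Abs_fps (\<lambda>N. if N < k then 0 else tail_geom x k l $ (N - k) / fact N)"

lemma tail_geom_Suc:
  "tail_geom x (Suc k) (a # l) = fps_geom (sum_list (map x (a # l))) * tail_geom x k l"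
  unfolding tail_geom_def prod.atMost_Suc_shift by simp

lemma tail_borel_0: "tail_borel x 0 l = fps_exp (sum_list (map x l))"
  by (rule fps_ext) (simp add: tail_borel_def tail_geom_def fps_geom_def)

text \<open>After division by factorials, multiplication by \<open>X\<close> acts as integration.
  The recursion \<open>P = T X P + tail_geom x k l\<close> for the geometric factor of the full sum
  \<open>T\<close> thus turns into a differential equation.\<close>

lemma tail_borel_deriv:
  "fps_deriv (tail_borel x (Suc k) (a # l)) =
     fps_const (sum_list (map x (a # l))) * tail_borel x (Suc k) (a # l) + tail_borel x k l"
proof (rule fps_ext)
  fix N
  define T where "T = sum_list (map x (a # l))"
  define P where "P = tail_geom x (Suc k) (a # l)"
  have P: "P = fps_const T * fps_X * P + tail_geom x k l"
    unfolding P_def tail_geom_Suc T_def by (rule fps_geom_mult)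
  have *: "of_nat (Suc N) * (c / fact (Suc N)) = c / fact N" for c :: 'a
    by (simp add: field_simps del: of_nat_Suc)
  show "fps_deriv (tail_borel x (Suc k) (a # l)) $ N =
     (fps_const (sum_list (map x (a # l))) * tail_borel x (Suc k) (a # l) + tail_borel x k l) $ N"
  proof (cases "N < k")
    case True
    then show ?thesis by (simp add: tail_borel_def)
  next
    case False
    have "fps_deriv (tail_borel x (Suc k) (a # l)) $ N = P $ (N - k) / fact N"
      using False * by (simp add: tail_borel_def P_def[symmetric] del: fact_Suc of_nat_Suc)
    also have "P $ (N - k) = (fps_const T * fps_X * P + tail_geom x k l) $ (N - k)"
      using P by simp
    also have "\<dots> = (if N = k then 0 else T * P $ (N - Suc k)) + tail_geom x k l $ (N - k)"
      using False by (simp add: mult.assoc)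
    also have "\<dots> / fact N =
      (fps_const T * tail_borel x (Suc k) (a # l) + tail_borel x k l) $ N"
      using False by (auto simp: tail_borel_def P_def[symmetric] add_divide_distrib)
    finally show ?thesis unfolding T_def .
  qed
qed

lemma sum_permutations_of_set_Cons:
  assumes "finite A" "A \<noteq> {}"
  shows "(\<Sum>l\<in>permutations_of_set A. f l) = (\<Sum>a\<in>A. \<Sum>l\<in>permutations_of_set (A - {a}). f (a # l))"
proof -
  have "(\<Sum>l\<in>permutations_of_set A. f l) =
      (\<Sum>a\<in>A. sum f ((#) a ` permutations_of_set (A - {a})))"
    unfolding permutations_of_set_nonempty[OF assms(2)]
    by (rule sum.UNION_disjoint) (use assms in auto)
  also have "\<dots> = (\<Sum>a\<in>A. \<Sum>l\<in>permutations_of_set (A - {a}). f (a # l))"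
    by (intro sum.cong[OF refl]) (subst sum.reindex, auto simp: inj_on_def)
  finally show ?thesis .
qed

lemma sum_list_permutation:
  "l \<in> permutations_of_set A \<Longrightarrow> sum_list (map x l) = sum x A"
  by (metis permutations_of_setD sum_list_distinct_conv_sum_set)

text \<open>Induction on \<open>k\<close> with \<open>A\<close> arbitrary, because splitting off the
  first entry of an ordering passes to \<open>A - {a}\<close>. In the step both sides have constant
  term zero and solve the same linear equation.\<close>

lemma tail_borel_sum_permutations:
  fixes x :: "'b \<Rightarrow> 'a::field_char_0"
  assumes "finite A" "k \<le> card A"
  shows "(\<Sum>l\<in>permutations_of_set A. tail_borel x k l) =
    fps_const (fact (card A - k)) * (\<Sum>K | K \<subseteq> A \<and> card K = k.
       (\<Prod>j\<in>K. fps_X * fps_exp_quot (x j)) * (\<Prod>j\<in>A-K. fps_exp (x j)))"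
  using assms
proof (induction k arbitrary: A)
  case 0
  have "{K. K \<subseteq> A \<and> card K = 0} = {{}}" using 0 finite_subset by fastforce
  moreover have "(\<Sum>l\<in>permutations_of_set A. tail_borel x 0 l) =
      (\<Sum>l\<in>permutations_of_set A. fps_exp (sum x A))"
    by (intro sum.cong refl) (simp add: tail_borel_0 sum_list_permutation)
  moreover have "fps_exp (sum x A) = (\<Prod>j\<in>A. fps_exp (x j))"
    using \<open>finite A\<close> by (induction A rule: finite_induct) (simp_all add: fps_exp_add_mult)
  ultimately show ?case using 0 by (simp add: fps_const_fact)
next
  case (Suc k)
  let ?g = "\<lambda>K. \<Prod>j\<in>K. fps_X * fps_exp_quot (x j)" and ?e = "\<lambda>K. \<Prod>j\<in>K. fps_exp (x j)"
  let ?S = "\<lambda>B k. {K. K \<subseteq> B \<and> card K = k}"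
  define W where "W B k = (\<Sum>K\<in>?S B k. ?g K * ?e (B - K))" for B k
  have fin: "finite (?S B k)" if "finite B" for B :: "'b set" and k
    using that by simp
  define T where "T = sum x A"
  have "A \<noteq> {}" using Suc.prems by auto
  \<comment> \<open>Cardinality and \<open>k\<close> drop together, so the factorial in front is the
    same for \<open>A\<close> and for every \<open>A - {a}\<close>.\<close>
  have c: "fact (card A - Suc k) = fact (card (A - {a}) - k)" "k \<le> card (A - {a})" if "a \<in> A" for a
    using that Suc.prems by (auto simp: card_Diff_singleton)
  have IH: "(\<Sum>l\<in>permutations_of_set (A - {a}). tail_borel x k l) =
     fps_const (fact (card A - Suc k)) * W (A - {a}) k" if "a \<in> A" for a
    unfolding W_def c(1)[OF that] using Suc.IH[OF _ c(2)[OF that]] Suc.prems by simp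
  show ?case unfolding W_def[symmetric]
  proof (rule fps_linear_ode_unique)
    let ?L = "\<Sum>l\<in>permutations_of_set A. tail_borel x (Suc k) l"
    let ?h = "\<Sum>a\<in>A. \<Sum>l\<in>permutations_of_set (A - {a}). tail_borel x k l"
    have "fps_deriv ?L = (\<Sum>a\<in>A. \<Sum>l\<in>permutations_of_set (A - {a}).
        fps_const T * tail_borel x (Suc k) (a # l) + tail_borel x k l)"
      unfolding sum_permutations_of_set_Cons[OF \<open>finite A\<close> \<open>A \<noteq> {}\<close>] fps_deriv_sum
    proof (intro sum.cong refl)
      fix a l assume "a \<in> A" "l \<in> permutations_of_set (A - {a})"
      then have "a # l \<in> permutations_of_set A"
        by (auto simp: permutations_of_set_def)
      from sum_list_permutation[OF this, of x]
      show "fps_deriv (tail_borel x (Suc k) (a # l)) =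
        fps_const T * tail_borel x (Suc k) (a # l) + tail_borel x k l"
        unfolding tail_borel_deriv T_def by simp
    qed
    also have "\<dots> = fps_const T * ?L + ?h"
      unfolding sum_permutations_of_set_Cons[OF \<open>finite A\<close> \<open>A \<noteq> {}\<close>] sum.distrib sum_distrib_left ..
    finally show "fps_deriv ?L = fps_const T * ?L + ?h" .
    \<comment> \<open>The derivative of the factor at \<open>a \<in> K\<close> is
      \<open>exp (x a)\<close>, which is \<open>x a\<close> times that factor plus \<open>1\<close>.
      The first part contributes to \<open>T\<close>, the second removes \<open>a\<close> from
      \<open>K\<close>.\<close>
    have dK: "fps_deriv (?g K * ?e (A - K)) =
        fps_const T * (?g K * ?e (A - K)) + (\<Sum>a\<in>K. ?g (K - {a}) * ?e (A - K))"
      if "K \<subseteq> A" for K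
    proof -
      have fK: "finite K" "finite (A - K)" using that Suc.prems finite_subset by auto
      have "fps_deriv (?g K) = (\<Sum>a\<in>K. fps_exp (x a) * ?g (K - {a}))"
        unfolding fps_deriv_prod[OF fK(1)] fps_deriv_X_exp_quot ..
      also have "\<dots> = (\<Sum>a\<in>K. fps_const (x a) * ?g K + ?g (K - {a}))"
      proof (intro sum.cong refl)
        fix a assume "a \<in> K"
        then show "fps_exp (x a) * ?g (K - {a}) = fps_const (x a) * ?g K + ?g (K - {a})"
          unfolding prod.remove[OF fK(1) \<open>a \<in> K\<close>] fps_exp_conv_quot[of "x a"]
          by (simp add: algebra_simps)
      qed
      also have "\<dots> = fps_const (sum x K) * ?g K + (\<Sum>a\<in>K. ?g (K - {a}))"
        by (simp add: sum.distrib sum_distrib_right fps_const_sum)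
      finally have 1: "fps_deriv (?g K) = fps_const (sum x K) * ?g K + (\<Sum>a\<in>K. ?g (K - {a}))" .
      have "fps_deriv (?e (A - K)) = (\<Sum>a\<in>A - K. fps_const (x a) * ?e (A - K))"
        unfolding fps_deriv_prod[OF fK(2)]
      proof (intro sum.cong refl)
        fix a assume a: "a \<in> A - K"
        show "fps_deriv (fps_exp (x a)) * ?e (A - K - {a}) = fps_const (x a) * ?e (A - K)"
          unfolding prod.remove[OF fK(2) a] by (simp add: mult.assoc)
      qed
      also have "\<dots> = fps_const (sum x (A - K)) * ?e (A - K)"
        by (simp add: sum_distrib_right fps_const_sum)
      finally have 2: "fps_deriv (?e (A - K)) = fps_const (sum x (A - K)) * ?e (A - K)" .
      have 3: "fps_const T = fps_const (sum x K) + fps_const (sum x (A - K))"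
        unfolding T_def using sum.subset_diff[OF that \<open>finite A\<close>, of x] by simp
      show ?thesis
        unfolding fps_deriv_mult 1 2 3
          by (simp add: algebra_simps sum_distrib_left del: fps_const_add)
    qed
    have "fps_deriv (W A (Suc k)) = fps_const T * W A (Suc k) +
        (\<Sum>K\<in>?S A (Suc k). \<Sum>a\<in>K. ?g (K - {a}) * ?e (A - K))"
      unfolding W_def fps_deriv_sum sum_distrib_left sum.distrib[symmetric]
      by (intro sum.cong refl dK) auto
    also have "(\<Sum>K\<in>?S A (Suc k). \<Sum>a\<in>K. ?g (K - {a}) * ?e (A - K)) =
        (\<Sum>(K,a)\<in>Sigma (?S A (Suc k)) (\<lambda>K. K). ?g (K - {a}) * ?e (A - K))"
      using fin[OF \<open>finite A\<close>] finite_subset[OF _ \<open>finite A\<close>] by (intro sum.Sigma) auto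
    \<comment> \<open>A set of size \<open>Suc k\<close> with a marked element is the same as an
      element \<open>a\<close> with a \<open>k\<close>-subset of \<open>A - {a}\<close>.\<close>
    also have "\<dots> = (\<Sum>(a,K)\<in>Sigma A (\<lambda>a. ?S (A - {a}) k). ?g K * ?e (A - {a} - K))"
    proof (rule sum.reindex_bij_witness[of _ "\<lambda>(a,K). (insert a K, a)" "\<lambda>(K,a). (a, K - {a})"], goal_cases)
      case (1 p)
      then show ?case by (auto simp: insert_absorb)
    next
      case (2 p)
      then show ?case by (auto simp: card_Diff_singleton)
    next
      case (3 p)
      then show ?case by auto
    next
      case (4 p)
      then show ?case using finite_subset[OF _ \<open>finite A\<close>]
        by (auto simp: card_insert_if finite_subset)
    next
      case (5 p)
      then obtain K a where [simp]: "p = (K, a)" and "K \<subseteq> A" "a \<in> K" by auto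
      then have "A - {a} - (K - {a}) = A - K" by auto
      then show ?case by simp
    qed
    also have "\<dots> = (\<Sum>a\<in>A. W (A - {a}) k)"
      unfolding W_def using Suc.prems fin by (intro sum.Sigma[symmetric]) auto
    finally have W: "fps_deriv (W A (Suc k)) = fps_const T * W A (Suc k) + (\<Sum>a\<in>A. W (A - {a}) k)" .
    have "?h = (\<Sum>a\<in>A. fps_const (fact (card A - Suc k)) * W (A - {a}) k)"
      by (intro sum.cong refl IH)
    then show "fps_deriv (fps_const (fact (card A - Suc k)) * W A (Suc k)) =
        fps_const T * (fps_const (fact (card A - Suc k)) * W A (Suc k)) + ?h"
      by (simp add: W sum_distrib_left algebra_simps)
    have "?g K $ 0 = 0" if "K \<in> ?S A (Suc k)" for K
    proof -
      from that have "K \<noteq> {}" by auto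
      then obtain a where a: "a \<in> K" by blast
      have "finite K" using that finite_subset[OF _ \<open>finite A\<close>] by auto
      then show ?thesis unfolding prod.remove[OF \<open>finite K\<close> a] by simp
    qed
    then show "?L $ 0 = (fps_const (fact (card A - Suc k)) * W A (Suc k)) $ 0"
      by (simp add: fps_sum_nth tail_borel_def W_def)
  qed
qed

section \<open>The average over the hyperoctahedral group\<close>

lemma fps_prod_nth_cong:
  assumes "finite A" "\<And>i r. i \<in> A \<Longrightarrow> r \<le> m \<Longrightarrow> f i $ r = g i $ r"
  shows "prod f A $ m = prod g A $ m"
  using assms
proof (induction A arbitrary: m rule: finite_induct)
  case (insert a A)
  have "prod f A $ r = prod g A $ r" if "r \<le> m" for r
    using that insert.prems by (intro insert.IH) auto
  then show ?case using insert by (auto simp: fps_mult_nth intro!: sum.cong)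
qed auto

lemma fps_const_prod: "fps_const (prod f A) = (\<Prod>a\<in>A. fps_const (f a))"
  by (induction A rule: infinite_finite_induct) (simp_all flip: fps_const_mult)

text \<open>Truncating every geometric series at degree \<open>m\<close> keeps coefficient
  \<open>m\<close> and leaves a product of finite sums, whose expansion runs over bounded exponent
  functions as in the definition.\<close>

lemma complete_homogeneous_conv_fps:
  "complete_homogeneous m j t = (\<Prod>i=1..j. fps_geom (t i)) $ m"
proof -
  let ?A = "{1..j} \<rightarrow>\<^sub>E {0..m}"
  have "(\<Prod>i=1..j. fps_geom (t i)) $ m
      = (\<Prod>i=1..j. \<Sum>r\<in>{0..m}. fps_const (t i ^ r) * fps_X ^ r) $ m"
    by (intro fps_prod_nth_cong) (auto simp: fps_sum_nth fps_geom_def if_distrib cong: if_cong)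
  also have "\<dots> = (\<Sum>g\<in>?A. \<Prod>i=1..j. fps_const (t i ^ g i) * fps_X ^ g i) $ m"
    by (subst prod_sum_PiE) auto
  also have "\<dots> = (\<Sum>g\<in>?A. fps_const (\<Prod>i=1..j. t i ^ g i) * fps_X ^ (\<Sum>i=1..j. g i)) $ m"
    by (simp only: prod.distrib power_sum fps_const_prod)
  also have "\<dots> = (\<Sum>g\<in>?A. if (\<Sum>i=1..j. g i) = m then \<Prod>i=1..j. t i ^ g i else 0)"
    by (auto simp: fps_sum_nth intro!: sum.cong)
  also have "\<dots> = complete_homogeneous m j t"
    unfolding complete_homogeneous_def by (subst sum.inter_filter[symmetric]) (auto intro!: finite_PiE)
  finally show ?thesis ..
qed

text \<open>Dropping \<open>i\<close> entries of \<open>1, ..., n\<close> leaves the tail that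
  starts at \<open>Suc i\<close>, hence the index shift between the two products. The empty tail
  gives the sum zero.\<close>

lemma h_tail_conv_tail_geom: "h_tail n m k x = tail_geom x k [1..<Suc n] $ m"
proof -
  have "sum_list (map x (drop i [1..<Suc n])) = tail_sum n x (Suc i)" for i
    by (simp add: tail_sum_def drop_upt sum_list_distinct_conv_sum_set atLeastLessThanSuc_atLeastAtMost
             del: upt_Suc)
  then have "(\<Prod>i=1..k+1. fps_geom (tail_sum n x i)) = tail_geom x k [1..<Suc n]"
    unfolding tail_geom_def
    by (intro prod.reindex_bij_witness[of _ Suc "\<lambda>i. i - 1"]) (auto simp del: upt_Suc drop_upt)
  then show ?thesis by (simp add: h_tail_def complete_homogeneous_conv_fps)
qed

lemma h_tail_permute:
  "h_tail n m k (\<lambda>i. x (\<pi> i)) = tail_geom x k (map \<pi> [1..<Suc n]) $ m"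
  by (simp add: h_tail_conv_tail_geom tail_geom_def drop_map o_def del: upt_Suc)

lemma h_tail_cong:
  assumes "\<And>i. i \<in> {1..n} \<Longrightarrow> x i = y i"
  shows "h_tail n m k x = h_tail n m k y"
proof -
  have "map x (drop i [1..<Suc n]) = map y (drop i [1..<Suc n])" for i
    using assms by (auto simp del: upt_Suc dest!: in_set_dropD)
  then show ?thesis by (simp add: h_tail_conv_tail_geom tail_geom_def del: upt_Suc drop_upt map_eq_conv)
qed

text \<open>Reading a permutation as its list of values is injective, and both sets have
  \<open>n!\<close> elements.\<close>

lemma sum_permutes_conv_permutations_of_set:
  "(\<Sum>\<pi> | \<pi> permutes {1..n}. f (map \<pi> [1..<Suc n])) = sum f (permutations_of_set {1..n})"
proof -
  let ?P = "{\<pi>. \<pi> permutes {1..n}}" and ?l = "\<lambda>\<pi>. map \<pi> [1..<Suc n]"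
  have "inj_on ?l ?P"
  proof (rule inj_onI, rule ext)
    fix \<pi> \<rho> i assume *: "\<pi> \<in> ?P" "\<rho> \<in> ?P" "?l \<pi> = ?l \<rho>"
    show "\<pi> i = \<rho> i"
    proof (cases "i \<in> {1..n}")
      case True
      then show ?thesis using *(3) by (simp del: upt_Suc)
    next
      case False
      then show ?thesis using *(1,2) by (simp add: permutes_not_in)
    qed
  qed
  moreover have "?l ` ?P = permutations_of_set {1..n}"
  proof (rule card_subset_eq)
    show "?l ` ?P \<subseteq> permutations_of_set {1..n}"
    proof safe
      fix \<pi> assume \<pi>: "\<pi> permutes {1..n}"
      show "?l \<pi> \<in> permutations_of_set {1..n}"
      proof (rule permutations_of_setI)
        show "set (?l \<pi>) = {1..n}"
          using permutes_image[OF \<pi>] by (simp add: atLeastLessThanSuc_atLeastAtMost del: upt_Suc)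
        show "distinct (?l \<pi>)"
          using permutes_inj_on[OF \<pi>] by (simp add: distinct_map del: upt_Suc)
      qed
    qed
    show "card (?l ` ?P) = card (permutations_of_set {1..n})"
      using \<open>inj_on ?l ?P\<close> by (simp add: card_image card_permutations[of "{1..n}" n] del: upt_Suc One_nat_def)
  qed auto
  ultimately show ?thesis
    by (metis (no_types, lifting) sum.reindex_cong)
qed

lemma sum_hyperoctahedral:
  fixes x :: "nat \<Rightarrow> real"
  assumes "\<And>x y. (\<And>i. i \<in> {1..n} \<Longrightarrow> x i = y i) \<Longrightarrow> f x = f y"
  shows "(\<Sum>\<sigma>\<in>hyperoctahedral n. f (hyperoctahedral_act \<sigma> x)) =
    (\<Sum>\<epsilon>\<in>{1..n} \<rightarrow>\<^sub>E {-1, 1}. \<Sum>\<pi> | \<pi> permutes {1..n}. f (\<lambda>i. \<epsilon> (\<pi> i) * x (\<pi> i)))"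
proof -
  let ?P = "{\<pi>. \<pi> permutes {1..n}}" and ?E = "{1..n} \<rightarrow>\<^sub>E {-1, 1 :: real}"
  \<comment> \<open>\<open>I\<close> is inversion in the group. It attaches each sign to a variable
    instead of a position, so that the signs can be fixed before the ordering is chosen.\<close>
  define I :: "(nat \<Rightarrow> nat) \<times> (nat \<Rightarrow> real) \<Rightarrow> (nat \<Rightarrow> nat) \<times> (nat \<Rightarrow> real)"
    where "I = (\<lambda>(\<pi>, \<epsilon>). (inv \<pi>, restrict (\<lambda>i. \<epsilon> (\<pi> i)) {1..n}))"
  define H where "H = (\<lambda>(\<pi>, \<epsilon>). f (\<lambda>i. \<epsilon> (\<pi> i) * x (\<pi> i)))"
  have i: "I \<sigma> \<in> ?P \<times> ?E" "I (I \<sigma>) = \<sigma>" if \<sigma>: "\<sigma> \<in> ?P \<times> ?E" for \<sigma>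
  proof -
    obtain \<pi> \<epsilon> where [simp]: "\<sigma> = (\<pi>, \<epsilon>)" and \<pi>: "\<pi> permutes {1..n}" and \<epsilon>: "\<epsilon> \<in> ?E"
      using \<sigma> by auto
    show "I \<sigma> \<in> ?P \<times> ?E"
      using \<epsilon> permutes_in_image[OF \<pi>] permutes_inv[OF \<pi>]
      by (auto simp: I_def PiE_iff simp del: atLeastAtMost_iff)
    have "restrict (\<lambda>i. restrict (\<lambda>i. \<epsilon> (\<pi> i)) {1..n} (inv \<pi> i)) {1..n} = \<epsilon>"
      using \<epsilon> permutes_in_image[OF permutes_inv[OF \<pi>]] permutes_inverses[OF \<pi>]
      by (auto simp: fun_eq_iff PiE_iff extensional_def simp del: atLeastAtMost_iff)
    then show "I (I \<sigma>) = \<sigma>" using permutes_inv_inv[OF \<pi>] by (simp add: I_def)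
  qed
  have f: "f (hyperoctahedral_act \<sigma> x) = H (I \<sigma>)"
    if \<sigma>: "\<sigma> \<in> ?P \<times> ?E" for \<sigma>
  proof -
    obtain \<pi> \<epsilon> where [simp]: "\<sigma> = (\<pi>, \<epsilon>)" and \<pi>: "\<pi> permutes {1..n}" and \<epsilon>: "\<epsilon> \<in> ?E"
      using \<sigma> by auto
    have "hyperoctahedral_act \<sigma> x i = restrict (\<lambda>i. \<epsilon> (\<pi> i)) {1..n} (inv \<pi> i) * x (inv \<pi> i)"
      if "i \<in> {1..n}" for i
      using that permutes_in_image[OF permutes_inv[OF \<pi>]] permutes_inverses[OF \<pi>]
      by (simp add: hyperoctahedral_act_def del: atLeastAtMost_iff)
    from assms[OF this] show ?thesis by (simp add: I_def H_def)
  qed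
  have "(\<Sum>\<sigma>\<in>hyperoctahedral n. f (hyperoctahedral_act \<sigma> x)) =
sum H (?P \<times> ?E)"
    unfolding hyperoctahedral_def
    by (rule sum.reindex_bij_witness[of _ I I]) (rule i f[symmetric]; assumption)+
  also have "\<dots> = (\<Sum>\<epsilon>\<in>?E. \<Sum>\<pi>\<in>?P. f (\<lambda>i. \<epsilon> (\<pi> i) * x (\<pi> i)))"
    by (subst sum.swap) (simp add: H_def sum.cartesian_product)
  finally show ?thesis .
qed

definition exp_quot_plus_exp :: "real \<Rightarrow> real \<Rightarrow> real fps" where
  "exp_quot_plus_exp t a = fps_exp_quot a + fps_const t * fps_exp a"

text \<open>Expanding the product on the right selects a set \<open>K\<close> of variables that
  contribute \<open>fps_exp_quot\<close>; the others give \<open>t ^ (n - k)\<close> with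
  \<open>k = card K\<close>. The \<open>k\<close> factors \<open>fps_X\<close> in
  \<open>tail_borel_sum_permutations\<close> account for the shift from \<open>m + k\<close> to
  \<open>m\<close>.\<close>

lemma sum_h_tail_permutations:
  "(\<Sum>k\<le>n. t ^ (n - k) / fact (n - k) *
      ((\<Sum>\<pi> | \<pi> permutes {1..n}. h_tail n m k (\<lambda>i. x (\<pi> i))) / fact (m + k)))
   = (\<Prod>j=1..n. exp_quot_plus_exp t (x j)) $ m"
proof -
  define W where "W K = (\<Prod>j\<in>K. fps_exp_quot (x j)) * (\<Prod>j\<in>{1..n}-K. fps_const t * fps_exp (x j))" for K
  have summand: "t ^ (n - k) / fact (n - k) *
      ((\<Sum>\<pi> | \<pi> permutes {1..n}. h_tail n m k (\<lambda>i. x (\<pi> i))) / fact (m + k)) =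
      (\<Sum>K | K \<in> Pow {1..n} \<and> card K = k. W K $ m)" if k: "k \<le> n" for k
  proof -
    have "(\<Sum>\<pi> | \<pi> permutes {1..n}. h_tail n m k (\<lambda>i. x (\<pi> i))) / fact (m + k)
       = (\<Sum>l\<in>permutations_of_set {1..n}. tail_geom x k l $ m) / fact (m + k)"
      unfolding h_tail_permute by (subst sum_permutes_conv_permutations_of_set) simp
    also have "\<dots> = (\<Sum>l\<in>permutations_of_set {1..n}. tail_borel x k l) $ (m + k)"
      by (simp add: tail_borel_def fps_sum_nth sum_divide_distrib)
    also have "\<dots> = fact (n - k) * (\<Sum>K | K \<subseteq> {1..n} \<and> card K = k.
       ((\<Prod>j\<in>K. fps_X * fps_exp_quot (x j)) * (\<Prod>j\<in>{1..n}-K. fps_exp (x j))) $ (m + k))"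
      using tail_borel_sum_permutations[of "{1..n}" k x] k by (simp add: fps_sum_nth)
    also have "(\<Sum>K | K \<subseteq> {1..n} \<and> card K = k.
       ((\<Prod>j\<in>K. fps_X * fps_exp_quot (x j)) * (\<Prod>j\<in>{1..n}-K. fps_exp (x j))) $ (m + k)) =
       (\<Sum>K | K \<subseteq> {1..n} \<and> card K = k.
       ((\<Prod>j\<in>K. fps_exp_quot (x j)) * (\<Prod>j\<in>{1..n}-K. fps_exp (x j))) $ m)"
      by (intro sum.cong) (auto simp: prod.distrib mult.assoc fps_X_power_mult_nth)
    finally have *: "(\<Sum>\<pi> | \<pi> permutes {1..n}. h_tail n m k (\<lambda>i. x (\<pi> i))) / fact (m + k) =
      fact (n - k) * (\<Sum>K | K \<subseteq> {1..n} \<and> card K = k.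
       ((\<Prod>j\<in>K. fps_exp_quot (x j)) * (\<Prod>j\<in>{1..n}-K. fps_exp (x j))) $ m)" .
    have "W K $ m = t ^ (n - k) * ((\<Prod>j\<in>K. fps_exp_quot (x j)) * (\<Prod>j\<in>{1..n}-K. fps_exp (x j))) $ m"
      if "K \<subseteq> {1..n}" "card K = k" for K
    proof -
      have "card ({1..n} - K) = n - k" using that by (simp add: card_Diff_subset finite_subset)
      then show ?thesis
        by (simp add: W_def prod.distrib fps_const_power mult.left_commute)
    qed
    then show ?thesis unfolding * by (simp add: sum_distrib_left)
  qed
  have "(\<Prod>j=1..n. exp_quot_plus_exp t (x j)) $ m = (\<Sum>K\<in>Pow {1..n}. W K $ m)"
    unfolding exp_quot_plus_exp_def W_def by (subst prod_add) (auto simp: fps_sum_nth)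
  also have "\<dots> = (\<Sum>k\<le>n. \<Sum>K | K \<in> Pow {1..n} \<and> card K = k. W K $ m)"
  proof (rule sum.group[symmetric])
    show "card ` Pow {1..n} \<subseteq> {..n}"
      using card_mono[of "{1..n}"] by fastforce
  qed auto
  finally show ?thesis using summand by simp
qed

text \<open>For fixed signs the sum over orderings is a product over the variables, so the sum over
  all signs factors as well. The normalisation \<open>1 / 2 ^ n\<close> gives \<open>1/2\<close> to
  each factor.\<close>

lemma sum_tau:
  "(\<Sum>k\<le>n. fact n / (fact (n - k) * fact (m + k)) * t ^ (n - k) * tau n m k x) =
     (\<Prod>j=1..n. fps_const (1/2) * (exp_quot_plus_exp t (- x j) + exp_quot_plus_exp t (x j))) $ m"
proof -
  let ?E = "{1..n} \<rightarrow>\<^sub>E {-1, 1 :: real}"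
  have tau: "tau n m k x = 1 / (2 ^ n * fact n) *
      (\<Sum>\<epsilon>\<in>?E. \<Sum>\<pi> | \<pi> permutes {1..n}. h_tail n m k (\<lambda>i. \<epsilon> (\<pi> i) * x (\<pi> i)))" for k
    unfolding tau_def by (subst sum_hyperoctahedral) (auto intro: h_tail_cong)
  have "(\<Sum>k\<le>n. fact n / (fact (n - k) * fact (m + k)) * t ^ (n - k) * tau n m k x) =
    1 / 2 ^ n * (\<Sum>k\<le>n. \<Sum>\<epsilon>\<in>?E. t ^ (n - k) / fact (n - k) *
      ((\<Sum>\<pi> | \<pi> permutes {1..n}. h_tail n m k (\<lambda>i. \<epsilon> (\<pi> i) * x (\<pi> i))) / fact (m + k)))"
    unfolding tau sum_distrib_left sum_divide_distrib
    by (intro sum.cong refl) simp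
  also have "\<dots> = 1 / 2 ^ n * (\<Sum>\<epsilon>\<in>?E. (\<Prod>j=1..n. exp_quot_plus_exp t (\<epsilon> j * x j)) $ m)"
    by (subst sum.swap) (simp only: sum_h_tail_permutations[where x = "\<lambda>i. _ i * x i"])
  also have "\<dots> = 1 / 2 ^ n * (\<Prod>j=1..n. \<Sum>e\<in>{-1, 1}. exp_quot_plus_exp t (e * x j)) $ m"
    by (subst prod_sum_PiE) (auto simp: fps_sum_nth)
  also have "\<dots> = (\<Prod>j=1..n. fps_const (1/2) * (exp_quot_plus_exp t (- x j) + exp_quot_plus_exp t (x j))) $ m"
    by (simp add: prod.distrib fps_const_power power_one_over del: fps_const_divide)
  finally show ?thesis .
qed

section \<open>Polynomials in the elementary symmetric functions\<close>

definition mpoly_mono :: "(nat \<Rightarrow>\<^sub>0 nat) \<Rightarrow> (nat \<Rightarrow> real) \<Rightarrow> real" where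
  "mpoly_mono \<mu> v = (\<Prod>i\<in>Poly_Mapping.keys \<mu>. v i ^ Poly_Mapping.lookup \<mu> i)"

lemma mpoly_mono_superset:
  assumes "finite A" "Poly_Mapping.keys \<mu> \<subseteq> A"
  shows "mpoly_mono \<mu> v = (\<Prod>i\<in>A. v i ^ Poly_Mapping.lookup \<mu> i)"
  unfolding mpoly_mono_def
  by (rule prod.mono_neutral_left) (use assms in \<open>auto simp: in_keys_iff\<close>)

lemma mpoly_mono_add: "mpoly_mono (\<mu> + \<nu>) v = mpoly_mono \<mu> v * mpoly_mono \<nu> v"
proof -
  let ?A = "Poly_Mapping.keys \<mu> \<union> Poly_Mapping.keys \<nu>"
  have "Poly_Mapping.keys (\<mu> + \<nu>) \<subseteq> ?A" by (rule Poly_Mapping.keys_add)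
  then show ?thesis
    by (simp add: mpoly_mono_superset[of ?A] lookup_add power_add prod.distrib)
qed

lemma mpoly_eval_superset:
  assumes "finite A" "Poly_Mapping.keys P \<subseteq> A"
  shows "mpoly_eval P v = (\<Sum>\<mu>\<in>A. Poly_Mapping.lookup P \<mu> * mpoly_mono \<mu> v)"
  unfolding mpoly_eval_def mpoly_mono_def
  by (rule sum.mono_neutral_left) (use assms in \<open>auto simp: in_keys_iff\<close>)

lemma mpoly_eval_add: "mpoly_eval (P + Q) v = mpoly_eval P v + mpoly_eval Q v"
proof -
  let ?A = "Poly_Mapping.keys P \<union> Poly_Mapping.keys Q"
  have "Poly_Mapping.keys (P + Q) \<subseteq> ?A" by (rule Poly_Mapping.keys_add)
  then show ?thesis
    by (simp add: mpoly_eval_superset[of ?A] lookup_add distrib_right sum.distrib)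
qed

lemma mpoly_eval_cong:
  assumes "\<And>i. i \<in> mpoly_vars P \<Longrightarrow> v i = w i"
  shows "mpoly_eval P v = mpoly_eval P w"
  unfolding mpoly_eval_def
  by (intro sum.cong prod.cong arg_cong2[of _ _ _ _ "(*)"] arg_cong2[of _ _ _ _ "(^)"] refl assms)
     (auto simp: mpoly_vars_def)

text \<open>The family \<open>e\<close> is substituted for the variables, with one polynomial for
  all points. Closure rules for this predicate replace explicit polynomials in the lower
  \<open>elem_sym_sq\<close>.\<close>

definition poly_fun_in :: "nat set \<Rightarrow> ('b \<Rightarrow> nat \<Rightarrow> real) \<Rightarrow> ('b \<Rightarrow> real) \<Rightarrow> bool" where
  "poly_fun_in V e g \<longleftrightarrow> (\<exists>P. mpoly_vars P \<subseteq> V \<and> (\<forall>x. g x = mpoly_eval P (e x)))"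

lemma poly_fun_in_mono: "poly_fun_in V e g \<Longrightarrow> V \<subseteq> W \<Longrightarrow> poly_fun_in W e g"
  unfolding poly_fun_in_def by blast

lemma poly_fun_in_monom:
  assumes "Poly_Mapping.keys \<mu> \<subseteq> V"
  shows "poly_fun_in V e (\<lambda>x. c * mpoly_mono \<mu> (e x))"
  unfolding poly_fun_in_def
proof (intro exI[of _ "Poly_Mapping.single \<mu> c"] conjI allI)
  show "mpoly_vars (Poly_Mapping.single \<mu> c) \<subseteq> V"
    using assms by (simp add: mpoly_vars_def)
  show "c * mpoly_mono \<mu> (e x) = mpoly_eval (Poly_Mapping.single \<mu> c) (e x)" for x
    by (simp add: mpoly_eval_def mpoly_mono_def)
qed

lemma poly_fun_in_const: "poly_fun_in V e (\<lambda>x. c)"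
  using poly_fun_in_monom[of 0 V e c] by (simp add: mpoly_mono_def)

lemma poly_fun_in_var: "i \<in> V \<Longrightarrow> poly_fun_in V e (\<lambda>x. e x i)"
  using poly_fun_in_monom[of "Poly_Mapping.single i 1" V e 1] by (simp add: mpoly_mono_def)

lemma poly_fun_in_add:
  assumes "poly_fun_in V e g" "poly_fun_in V e h"
  shows "poly_fun_in V e (\<lambda>x. g x + h x)"
proof -
  from assms obtain P Q where "mpoly_vars P \<subseteq> V" "\<forall>x. g x = mpoly_eval P (e x)"
    "mpoly_vars Q \<subseteq> V" "\<forall>x. h x = mpoly_eval Q (e x)"
    unfolding poly_fun_in_def by blast
  moreover have "mpoly_vars (P + Q) \<subseteq> mpoly_vars P \<union> mpoly_vars Q"
    unfolding mpoly_vars_def using Poly_Mapping.keys_add[of P Q] by blast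
  ultimately show ?thesis
    unfolding poly_fun_in_def by (intro exI[of _ "P + Q"]) (auto simp: mpoly_eval_add)
qed

lemma poly_fun_in_sum:
  assumes "\<And>a. a \<in> A \<Longrightarrow> poly_fun_in V e (g a)"
  shows "poly_fun_in V e (\<lambda>x. \<Sum>a\<in>A. g a x)"
  using assms
  by (induction A rule: infinite_finite_induct) (auto intro: poly_fun_in_const poly_fun_in_add)

text \<open>The product of the values is expanded into monomials, so only the multiplicativity of
  \<open>mpoly_mono\<close> is involved.\<close>

lemma poly_fun_in_mult:
  assumes "poly_fun_in V e g" "poly_fun_in V e h"
  shows "poly_fun_in V e (\<lambda>x. g x * h x)"
proof -
  from assms obtain P Q where PQ: "mpoly_vars P \<subseteq> V" "\<forall>x. g x = mpoly_eval P (e x)"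
    "mpoly_vars Q \<subseteq> V" "\<forall>x. h x = mpoly_eval Q (e x)"
    unfolding poly_fun_in_def by blast
  have "(\<lambda>x. g x * h x) = (\<lambda>x. \<Sum>\<mu>\<in>Poly_Mapping.keys P. \<Sum>\<nu>\<in>Poly_Mapping.keys Q.
      (Poly_Mapping.lookup P \<mu> * Poly_Mapping.lookup Q \<nu>) * mpoly_mono (\<mu> + \<nu>) (e x))"
    unfolding mpoly_mono_add
    by (simp add: PQ mpoly_eval_superset[OF finite_keys order_refl] sum_product mult_ac)
  moreover have "Poly_Mapping.keys (\<mu> + \<nu>) \<subseteq> V"
    if "\<mu> \<in> Poly_Mapping.keys P" "\<nu> \<in> Poly_Mapping.keys Q" for \<mu> \<nu>
    using that PQ(1,3) Poly_Mapping.keys_add[of \<mu> \<nu>] unfolding mpoly_vars_def by blast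
  ultimately show ?thesis
    by (auto intro!: poly_fun_in_sum poly_fun_in_monom)
qed

lemma poly_fun_in_cmult: "poly_fun_in V e g \<Longrightarrow> poly_fun_in V e (\<lambda>x. c * g x)"
  by (intro poly_fun_in_mult poly_fun_in_const)

lemma poly_fun_in_diff:
  assumes "poly_fun_in V e g" "poly_fun_in V e h"
  shows "poly_fun_in V e (\<lambda>x. g x - h x)"
  using poly_fun_in_add[OF assms(1) poly_fun_in_cmult[OF assms(2), of "-1"]] by simp

section \<open>Products of scaled series and their logarithmic derivatives\<close>

definition fps_scale :: "'a::comm_ring_1 \<Rightarrow> 'a fps \<Rightarrow> 'a fps" where
  "fps_scale c f = f oo (fps_const c * fps_X)"

lemma fps_scale_nth: "fps_scale c f $ n = c ^ n * f $ n"
  by (simp add: fps_scale_def fps_compose_linear)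

lemma fps_scale_mult: "fps_scale (c::'a::idom) (f * g) = fps_scale c f * fps_scale c g"
  by (simp add: fps_scale_def fps_compose_mult_distrib)

lemma fps_scale_X_deriv: "fps_X * fps_deriv (fps_scale c f) = fps_scale c (fps_X * fps_deriv f)"
proof (rule fps_ext)
  fix n show "(fps_X * fps_deriv (fps_scale c f)) $ n = fps_scale c (fps_X * fps_deriv f) $ n"
    by (cases n) (simp_all add: fps_scale_nth mult_ac)
qed

text \<open>The Euler operator \<open>X d/dX\<close> in place of \<open>d/dX\<close> keeps the degrees aligned.\<close>

definition fps_log_deriv :: "'a::field fps \<Rightarrow> 'a fps" where
  "fps_log_deriv f = fps_X * fps_deriv f / f"

lemma fps_log_deriv_mult:
  assumes "f $ 0 \<noteq> 0"
  shows "f * fps_log_deriv f = fps_X * fps_deriv f"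
  using assms inverse_mult_eq_1[OF assms]
  by (simp add: fps_log_deriv_def fps_divide_unit mult_ac)

lemma fps_log_deriv_nth_0: "f $ 0 \<noteq> 0 \<Longrightarrow> fps_log_deriv f $ 0 = 0"
  using arg_cong[OF fps_log_deriv_mult[of f], of "\<lambda>g. g $ 0"] by simp

lemma fps_prod_nth_0: "prod f A $ 0 = (\<Prod>a\<in>A. f a $ 0)"
  by (induction A rule: infinite_finite_induct) simp_all

text \<open>The logarithmic derivative of the product is the sum of those of its factors, and
  scaling by \<open>y j\<close> multiplies coefficient \<open>k\<close> by \<open>y j ^ k\<close>.
  Hence the power sums appear.\<close>

lemma prod_fps_scale_recurrence:
  fixes f :: "'a::field fps"
  assumes "finite A" "f $ 0 \<noteq> 0"
  shows "of_nat m * (\<Prod>j\<in>A. fps_scale (y j) f) $ m =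
    (\<Sum>i=0..m. (\<Prod>j\<in>A. fps_scale (y j) f) $ i * (fps_log_deriv f $ (m - i) * (\<Sum>j\<in>A. y j ^ (m - i))))"
proof -
  let ?Q = "\<Prod>j\<in>A. fps_scale (y j) f"
  have "fps_X * fps_deriv ?Q = (\<Sum>a\<in>A. fps_X * fps_deriv (fps_scale (y a) f) * (\<Prod>j\<in>A-{a}. fps_scale (y j) f))"
    by (simp add: fps_deriv_prod[OF assms(1)] sum_distrib_left mult.assoc)
  also have "\<dots> = (\<Sum>a\<in>A. ?Q * fps_scale (y a) (fps_log_deriv f))"
  proof (intro sum.cong refl)
    fix a assume a: "a \<in> A"
    show "fps_X * fps_deriv (fps_scale (y a) f) * (\<Prod>j\<in>A-{a}. fps_scale (y j) f) =
      ?Q * fps_scale (y a) (fps_log_deriv f)"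
      unfolding fps_scale_X_deriv fps_log_deriv_mult[OF assms(2), symmetric] fps_scale_mult
        prod.remove[OF assms(1) a] by (simp add: mult_ac)
  qed
  also have "\<dots> = ?Q * (\<Sum>a\<in>A. fps_scale (y a) (fps_log_deriv f))"
    by (simp add: sum_distrib_left)
  finally have "(fps_X * fps_deriv ?Q) $ m = (?Q * (\<Sum>a\<in>A. fps_scale (y a) (fps_log_deriv f))) $ m"
    by simp
  moreover have "(fps_X * fps_deriv ?Q) $ m = of_nat m * ?Q $ m"
    by (cases m) simp_all
  moreover have "(\<Sum>a\<in>A. fps_scale (y a) (fps_log_deriv f)) $ k = fps_log_deriv f $ k * (\<Sum>j\<in>A. y j ^ k)" for k
    by (simp add: fps_sum_nth fps_scale_nth sum_distrib_left mult_ac)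
  ultimately show ?thesis
    by (simp only: fps_mult_nth[of ?Q])
qed

lemma elem_sym_sq_conv_fps:
  "elem_sym_sq n i x = (\<Prod>j=1..n. fps_scale ((x j)\<^sup>2) (1 + fps_X)) $ i"
proof -
  have [simp]: "fps_scale c (1 + fps_X) = fps_const c * fps_X + 1" for c :: real
    by (rule fps_ext) (auto simp: fps_scale_nth le_Suc_eq)
  have "(\<Prod>j=1..n. fps_scale ((x j)\<^sup>2) (1 + fps_X)) =
      (\<Sum>S\<in>Pow {1..n}. fps_const (\<Prod>j\<in>S. (x j)\<^sup>2) * fps_X ^ card S)"
    by (simp add: prod_add prod.distrib fps_const_prod)
  also have "\<dots> $ i = (\<Sum>S\<in>Pow {1..n}. if card S = i then \<Prod>j\<in>S. (x j)\<^sup>2 else 0)"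
    by (auto simp: fps_sum_nth intro!: sum.cong)
  also have "\<dots> = elem_sym_sq n i x"
    unfolding elem_sym_sq_def by (subst sum.inter_filter[symmetric]) auto
  finally show ?thesis ..
qed

lemma fps_log_deriv_1_plus_X: "m > 0 \<Longrightarrow> fps_log_deriv (1 + fps_X :: real fps) $ m = (-1) ^ (m - 1)"
proof -
  assume "m > 0"
  let ?l = "fps_log_deriv (1 + fps_X :: real fps)"
  have *: "(1 + fps_X) * ?l = fps_X" using fps_log_deriv_mult[of "1 + fps_X :: real fps"] by simp
  have "?l $ Suc k = (-1) ^ k" for k
  proof (induction k)
    case 0
    then show ?case using arg_cong[OF *, of "\<lambda>g. g $ 1"] fps_log_deriv_nth_0[of "1 + fps_X :: real fps"]
      by (simp add: distrib_right)
  next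
    case (Suc k)
    then show ?case using arg_cong[OF *, of "\<lambda>g. g $ Suc (Suc k)"] by (simp add: distrib_right)
  qed
  from this[of "m - 1"] show ?thesis using \<open>m > 0\<close> by simp
qed

lemma sum_atLeast0_atMost_split_ends:
  fixes f :: "nat \<Rightarrow> 'a::comm_monoid_add"
  assumes "m > 0"
  shows "sum f {0..m} = f 0 + sum f {1..<m} + f m"
proof -
  have "{0..m} = insert 0 (insert m {1..<m})" using assms by auto
  then show ?thesis using assms by (simp add: add_ac)
qed

text \<open>Newton's identities are the case \<open>f = 1 + X\<close> of the recurrence.\<close>

lemma power_sum_leading_coeff:
  assumes "m > 0"
  shows "poly_fun_in {1..<m} (\<lambda>x i. elem_sym_sq n i x)
    (\<lambda>x. (\<Sum>j=1..n. ((x j)\<^sup>2) ^ m) - (-1) ^ (m - 1) * real m * elem_sym_sq n m x)"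
  using assms
proof (induction m rule: less_induct)
  case (less m)
  let ?e = "\<lambda>x i. elem_sym_sq n i x" and ?p = "\<lambda>r x. \<Sum>j=1..n. ((x j :: real)\<^sup>2) ^ r"
  let ?l = "fps_log_deriv (1 + fps_X :: real fps)"
  have e0: "?e x 0 = 1" for x
  proof -
    have "{S. S \<subseteq> {1..n} \<and> card S = 0} = {{}}"
      using finite_subset[of _ "{1..n}"] by fastforce
    then show ?thesis by (simp add: elem_sym_sq_def del: card_eq_0_iff)
  qed
  have "real m * ?e x m = (\<Sum>i=0..m. ?e x i * (?l $ (m - i) * ?p (m - i) x))" for x
    unfolding elem_sym_sq_conv_fps
    by (rule prod_fps_scale_recurrence) simp_all
  then have "real m * ?e x m = (-1) ^ (m - 1) * ?p m x + (\<Sum>i=1..<m. ?e x i * (?l $ (m - i) * ?p (m - i) x))" for x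
    using less.prems
    by (simp add: sum_atLeast0_atMost_split_ends e0 fps_log_deriv_1_plus_X fps_log_deriv_nth_0)
  \<comment> \<open>Here \<open>s\<close> stands for the sign \<open>(-1) ^ (m - 1)\<close>.
    Multiplying Newton's identity by it isolates the power sum \<open>P\<close>.\<close>
  moreover have "P - s * M * E = (-1) * s * S"
    if "M * E = s * P + S" "s * s = 1" for M E P S s :: real
    using that by algebra
  ultimately have *: "?p m x - (-1) ^ (m - 1) * real m * ?e x m =
      (-1) * (-1) ^ (m - 1) * (\<Sum>i=1..<m. ?e x i * (?l $ (m - i) * ?p (m - i) x))" for x
    by (simp flip: power_add)
  have p: "poly_fun_in {1..<m} ?e (?p r)" if "r < m" "0 < r" for r
  proof -
    have "poly_fun_in {1..<m} ?e (\<lambda>x. (?p r x - (-1) ^ (r - 1) * real r * ?e x r) + (-1) ^ (r - 1) * real r * ?e x r)"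
      by (intro poly_fun_in_add poly_fun_in_mult poly_fun_in_const poly_fun_in_var
          poly_fun_in_mono[OF less.IH]) (use that in auto)
    then show ?thesis by simp
  qed
  show ?case unfolding *
    by (intro poly_fun_in_cmult poly_fun_in_sum poly_fun_in_mult poly_fun_in_const poly_fun_in_var p) auto
qed

text \<open>In the recurrence the term \<open>i = m\<close> vanishes, the terms with
  \<open>0 < i < m\<close> involve only lower functions, and \<open>i = 0\<close> brings in the
  \<open>m\<close>-th power sum. Its leading coefficient \<open>(-1) ^ (m - 1) * real m\<close>
  cancels the factor \<open>m\<close> on the left.\<close>

lemma prod_fps_scale_leading_coeff:
  fixes f :: "real fps"
  assumes "f $ 0 \<noteq> 0" "m > 0"
  shows "poly_fun_in {1..<m} (\<lambda>x i. elem_sym_sq n i x)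
    (\<lambda>x. (\<Prod>j=1..n. fps_scale ((x j)\<^sup>2) f) $ m
        - (f $ 0) ^ n * (-1) ^ (m - 1) * fps_log_deriv f $ m * elem_sym_sq n m x)"
  using assms(2)
proof (induction m rule: less_induct)
  case (less m)
  let ?e = "\<lambda>x i. elem_sym_sq n i x" and ?p = "\<lambda>r x. \<Sum>j=1..n. ((x j :: real)\<^sup>2) ^ r"
  let ?Q = "\<lambda>x. \<Prod>j=1..n. fps_scale ((x j)\<^sup>2) f"
  let ?l = "fps_log_deriv f"
  have Q0: "?Q x $ 0 = (f $ 0) ^ n" for x
    by (simp add: fps_prod_nth_0 fps_scale_nth)
  have "real m * ?Q x $ m = (\<Sum>i=0..m. ?Q x $ i * (?l $ (m - i) * ?p (m - i) x))" for x
    by (rule prod_fps_scale_recurrence) (simp_all add: assms)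
  then have "real m * ?Q x $ m = (f $ 0) ^ n * (?l $ m * ?p m x) + (\<Sum>i=1..<m. ?Q x $ i * (?l $ (m - i) * ?p (m - i) x))" for x
    using less.prems
    by (simp add: sum_atLeast0_atMost_split_ends Q0 fps_log_deriv_nth_0 assms del: One_nat_def)
  then have *: "?Q x $ m - (f $ 0) ^ n * (-1) ^ (m - 1) * ?l $ m * ?e x m = 1 / real m *
     ((f $ 0) ^ n * ?l $ m * (?p m x - (-1) ^ (m - 1) * real m * ?e x m)
       + (\<Sum>i=1..<m. ?Q x $ i * (?l $ (m - i) * ?p (m - i) x)))" for x
    using less.prems by (simp add: field_simps)
  have p: "poly_fun_in {1..<m} ?e (?p r)" if "r < m" "0 < r" for r
  proof -
    have "poly_fun_in {1..<m} ?e (\<lambda>x. (?p r x - (-1) ^ (r - 1) * real r * ?e x r) + (-1) ^ (r - 1) * real r * ?e x r)"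
      by (intro poly_fun_in_add poly_fun_in_mult poly_fun_in_const poly_fun_in_var
          poly_fun_in_mono[OF power_sum_leading_coeff]) (use that in auto)
    then show ?thesis by simp
  qed
  have Q: "poly_fun_in {1..<m} ?e (\<lambda>x. ?Q x $ i)" if "i < m" "0 < i" for i
  proof -
    have "poly_fun_in {1..<m} ?e (\<lambda>x. (?Q x $ i - (f $ 0) ^ n * (-1) ^ (i - 1) * ?l $ i * ?e x i)
        + (f $ 0) ^ n * (-1) ^ (i - 1) * ?l $ i * ?e x i)"
      by (intro poly_fun_in_add poly_fun_in_mult poly_fun_in_const poly_fun_in_var
          poly_fun_in_mono[OF less.IH]) (use that in auto)
    then show ?thesis by simp
  qed
  show ?case unfolding *
    by (intro poly_fun_in_cmult poly_fun_in_add poly_fun_in_sum poly_fun_in_mult poly_fun_in_const p Q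
        power_sum_leading_coeff less.prems) auto
qed

section \<open>Independence of the elementary symmetric functions\<close>

lemma sum_card_prod_eq_coeff:
  fixes y :: "nat \<Rightarrow> real"
  assumes "i \<le> m"
  shows "(\<Sum>S | S \<subseteq> {1..m} \<and> card S = i. prod y S) = coeff (\<Prod>j=1..m. [:y j, 1:]) (m - i)"
proof -
  have split: "[:y j, 1:] = [:y j:] + monom 1 1" for j by (simp add: monom_altdef)
  have p: "(\<Prod>j\<in>S. [:y j:]) = [:prod y S:]" for S
    by (induction S rule: infinite_finite_induct) simp_all
  have "coeff (\<Prod>j=1..m. [:y j, 1:]) (m - i) =
      (\<Sum>S\<in>Pow {1..m}. coeff ([:prod y S:] * monom 1 (card ({1..m} - S))) (m - i))"
    unfolding split by (subst prod_add) (simp_all add: p coeff_sum monom_power)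
  also have "\<dots> = (\<Sum>S\<in>Pow {1..m}. if card S = i then prod y S else 0)"
  proof (intro sum.cong refl)
    fix S assume "S \<in> Pow {1..m}"
    then have "card ({1..m} - S) = m - card S" "card S \<le> m"
      using card_mono[of "{1..m}" S] by (auto simp: card_Diff_subset finite_subset)
    then show "coeff ([:prod y S:] * monom 1 (card ({1..m} - S))) (m - i) =
        (if card S = i then prod y S else 0)"
      using assms by auto
  qed
  also have "\<dots> = (\<Sum>S | S \<subseteq> {1..m} \<and> card S = i. prod y S)"
    by (subst sum.inter_filter[symmetric]) auto
  finally show ?thesis ..
qed

lemma elem_sym_sq_eq_coeff:
  assumes "i \<le> m" "m \<le> n" "\<And>j. j > m \<Longrightarrow> x j = 0"
  shows "elem_sym_sq n i x = coeff (\<Prod>j=1..m. [:(x j)\<^sup>2, 1:]) (m - i)"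
proof -
  have "elem_sym_sq n i x = (\<Sum>S | S \<subseteq> {1..m} \<and> card S = i. \<Prod>j\<in>S. (x j)\<^sup>2)"
    unfolding elem_sym_sq_def
  proof (rule sum.mono_neutral_right)
    show "\<forall>S\<in>{S. S \<subseteq> {1..n} \<and> card S = i} - {S. S \<subseteq> {1..m} \<and> card S = i}. (\<Prod>j\<in>S. (x j)\<^sup>2) = 0"
    proof
      fix S assume S: "S \<in> {S. S \<subseteq> {1..n} \<and> card S = i} - {S. S \<subseteq> {1..m} \<and> card S = i}"
      then obtain j where "j \<in> S" "j > m" by (auto simp: subset_iff)
      moreover have "finite S" using S finite_subset[of S "{1..n}"] by auto
      ultimately show "(\<Prod>j\<in>S. (x j)\<^sup>2) = 0" using assms(3)[of j] by (auto intro: prod_zero)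
    qed
  qed (use assms in auto)
  then show ?thesis using sum_card_prod_eq_coeff[OF assms(1)] by simp
qed

text \<open>
  At the half-integers the polynomial alternates in sign, so it keeps its simple negative roots
  under a small change of the constant term.
\<close>

lemma shifted_product_splits:
  assumes "1 \<le> m"
  obtains \<epsilon> :: real and r :: "nat \<Rightarrow> real" where "\<epsilon> > 0" "\<And>i. i \<in> {1..m} \<Longrightarrow> r i > 0"
    "(\<Prod>i=1..m. [:r i, 1:]) = (\<Prod>i=1..m. [:real i, 1:]) + [:\<epsilon>:]"
proof -
  define q where "q = (\<Prod>i=1..m. [:real i, 1:])"
  define a b where "a i = - real i - 1/2" and "b i = - real i + 1/2" for i :: nat
  have alt: "poly q (a i) * poly q (b i) < 0" if i: "i \<in> {1..m}" for i
  proof -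
    \<comment> \<open>The interval ends \<open>a i\<close> and \<open>b i\<close> lie on the same
      side of every root \<open>- real j\<close> with \<open>j \<noteq> i\<close> and on opposite
      sides of \<open>- real i\<close>, where the factor is \<open>-1/4\<close>.\<close>
    let ?h = "\<lambda>j. (real j + a i) * (real j + b i)"
    have "?h j > 0" if "j \<noteq> i" for j
    proof -
      have "real j + a i > 0 \<or> real j + b i < 0"
        using that by (cases "j < i") (auto simp: a_def b_def)
      then show ?thesis by (auto simp: a_def b_def intro: mult_pos_pos mult_neg_neg)
    qed
    then have "prod ?h ({1..m} - {i}) > 0" by (intro prod_pos) auto
    moreover have "poly q (a i) * poly q (b i) = prod ?h {1..m}"
      by (simp add: q_def poly_prod add.commute flip: prod.distrib)
    moreover have "prod ?h {1..m} = - (1/4) * prod ?h ({1..m} - {i})"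
      using i by (simp add: prod.remove[of _ i] a_def b_def)
    ultimately show ?thesis by simp
  qed
  \<comment> \<open>Half of the minimum is smaller than every \<open>\<bar>poly q\<bar>\<close> at
    the half-integers, so adding it preserves all signs there.\<close>
  define B where "B = insert 1 ((\<lambda>i. \<bar>poly q (a i)\<bar>) ` {1..m} \<union> (\<lambda>i. \<bar>poly q (b i)\<bar>) ` {1..m})"
  define \<epsilon> where "\<epsilon> = Min B / 2"
  have B: "finite B" "B \<noteq> {}" by (auto simp: B_def)
  have "Min B > 0"
    unfolding Min_gr_iff[OF B] using alt by (fastforce simp: B_def)
  then have \<epsilon>: "\<epsilon> > 0" "\<epsilon> < Min B" by (auto simp: \<epsilon>_def)
  have "\<exists>z>a i. z < b i \<and> poly (q + [:\<epsilon>:]) z = 0" if i: "i \<in> {1..m}" for i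
  proof (rule poly_IVT)
    show "a i < b i" by (simp add: a_def b_def)
    have "\<bar>poly q (a i)\<bar> \<in> B" "\<bar>poly q (b i)\<bar> \<in> B" using i by (auto simp: B_def)
    then have "\<epsilon> < \<bar>poly q (a i)\<bar>" "\<epsilon> < \<bar>poly q (b i)\<bar>"
      using \<epsilon>(2) Min_le[OF B(1)] by fastforce+
    with alt[OF i] \<epsilon>(1) show "poly (q + [:\<epsilon>:]) (a i) * poly (q + [:\<epsilon>:]) (b i) < 0"
      by (auto simp: mult_less_0_iff)
  qed
  then obtain z where z: "\<And>i. i \<in> {1..m} \<Longrightarrow> a i < z i \<and> z i < b i \<and> poly (q + [:\<epsilon>:]) (z i) = 0"
    by metis
  have "inj_on z {1..m}"
  proof (rule linorder_inj_onI')
    fix i j assume "i \<in> {1..m}" "j \<in> {1..m}" "i < j"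
    then show "z i \<noteq> z j" using z[of i] z[of j] by (auto simp: a_def b_def)
  qed
  have deg: "degree (\<Prod>i=1..m. [:g i, 1:]) = m" "coeff (\<Prod>i=1..m. [:g i, 1:]) m = 1" for g :: "nat \<Rightarrow> real"
  proof -
    show *: "degree (\<Prod>i=1..m. [:g i, 1:]) = m" by (subst degree_prod_eq_sum_degree) auto
    show "coeff (\<Prod>i=1..m. [:g i, 1:]) m = 1"
      using lead_coeff_prod[of "\<lambda>i. [:g i, 1:]" "{1..m}"] by (simp add: * del: One_nat_def)
  qed
  \<comment> \<open>Both sides are monic of degree \<open>m\<close>, as the constant
    \<open>\<epsilon>\<close> does not reach the top coefficient for \<open>m \<ge> 1\<close>, and
    both vanish at the \<open>m\<close> distinct points \<open>z i\<close>.\<close>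
  have "(\<Prod>i=1..m. [:- z i, 1:]) = q + [:\<epsilon>:]"
  proof (rule poly_eqI_degree_lead_coeff[where A = "z ` {1..m}" and n = m])
    show "coeff (\<Prod>i=1..m. [:- z i, 1:]) m = coeff (q + [:\<epsilon>:]) m"
      using assms by (simp add: q_def deg coeff_eq_0 del: One_nat_def)
    show "m \<le> card (z ` {1..m})" using \<open>inj_on z {1..m}\<close> by (simp add: card_image)
    show "degree (\<Prod>i=1..m. [:- z i, 1:]) \<le> m" by (simp add: deg del: One_nat_def)
    show "degree (q + [:\<epsilon>:]) \<le> m" unfolding q_def by (intro degree_add_le) (simp_all add: deg del: One_nat_def)
    fix w assume "w \<in> z ` {1..m}"
    then obtain i where i: "i \<in> {1..m}" "w = z i" by blast
    then have "poly (\<Prod>i=1..m. [:- z i, 1:]) w = 0"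
      unfolding poly_prod by (intro prod_zero) (auto intro: bexI[of _ i])
    then show "poly (\<Prod>i=1..m. [:- z i, 1:]) w = poly (q + [:\<epsilon>:]) w"
      using z[OF i(1)] i(2) by simp
  qed
  moreover have "- z i > 0" if "i \<in> {1..m}" for i using z[OF that] that by (auto simp: b_def)
  ultimately show thesis using that[of \<epsilon> "\<lambda>i. - z i"] \<epsilon>(1) unfolding q_def by blast
qed

text \<open>Two points are found that agree in all lower functions but not in the
  \<open>m\<close>-th. Their squared coordinates are the \<open>r i\<close> and the numbers
  \<open>1, ..., m\<close>, padded with zeros; the two polynomials differ only in the constant term,
  which is the value of the \<open>m\<close>-th function.\<close>

lemma elem_sym_sq_independent:
  assumes "1 \<le> m" "m \<le> n" "poly_fun_in {1..<m} (\<lambda>x i. elem_sym_sq n i x) (\<lambda>x. c * elem_sym_sq n m x)"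
  shows "c = 0"
proof -
  obtain \<epsilon> :: real and r :: "nat \<Rightarrow> real" where \<epsilon>: "\<epsilon> > 0" and r: "\<And>i. i \<in> {1..m} \<Longrightarrow> r i > 0"
    and eq: "(\<Prod>i=1..m. [:r i, 1:]) = (\<Prod>i=1..m. [:real i, 1:]) + [:\<epsilon>:]"
    using shifted_product_splits[OF assms(1)] by metis
  define x where "x j = (if j \<le> m then sqrt (r j) else 0)" for j
  define z where "z j = (if j \<le> m then sqrt (real j) else 0)" for j
  have x: "elem_sym_sq n i x = coeff (\<Prod>j=1..m. [:r j, 1:]) (m - i)" if "i \<le> m" for i
  proof -
    have "(\<Prod>j=1..m. [:(x j)\<^sup>2, 1:]) = (\<Prod>j=1..m. [:r j, 1:])"
      by (intro prod.cong refl) (use r in \<open>auto simp: x_def less_imp_le\<close>)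
    then show ?thesis using elem_sym_sq_eq_coeff[OF that assms(2), of x] by (simp add: x_def)
  qed
  have z: "elem_sym_sq n i z = coeff (\<Prod>j=1..m. [:real j, 1:]) (m - i)" if "i \<le> m" for i
  proof -
    have "(\<Prod>j=1..m. [:(z j)\<^sup>2, 1:]) = (\<Prod>j=1..m. [:real j, 1:])"
      by (intro prod.cong refl) (auto simp: z_def)
    then show ?thesis using elem_sym_sq_eq_coeff[OF that assms(2), of z] by (simp add: z_def)
  qed
  have "elem_sym_sq n m x = elem_sym_sq n m z + \<epsilon>"
    by (simp only: x z eq order_refl) simp
  moreover have "elem_sym_sq n i x = elem_sym_sq n i z" if i: "i \<in> {1..<m}" for i
  proof -
    obtain d where "m - i = Suc d" using i by (cases "m - i") auto
    then show ?thesis using i by (simp add: x z eq del: One_nat_def)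
  qed
  moreover obtain P where P: "mpoly_vars P \<subseteq> {1..<m}"
    "\<And>x. c * elem_sym_sq n m x = mpoly_eval P (\<lambda>i. elem_sym_sq n i x)"
    using assms(3) unfolding poly_fun_in_def by blast
  ultimately have "c * elem_sym_sq n m x = c * elem_sym_sq n m z"
    unfolding P(2) by (intro mpoly_eval_cong) auto
  with \<open>elem_sym_sq n m x = elem_sym_sq n m z + \<epsilon>\<close> \<epsilon> show ?thesis by simp
qed

text \<open>Passing from \<open>f t\<close> to \<open>f (2 t) - 2\<^sup>n f t\<close> eliminates the top coefficient.\<close>

lemma coeff_closed_of_poly_closed:
  fixes f :: "nat \<Rightarrow> 'b \<Rightarrow> real"
  assumes add: "\<And>g h. S g \<Longrightarrow> S h \<Longrightarrow> S (\<lambda>x. g x + h x)"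
    and cmult: "\<And>c g. S g \<Longrightarrow> S (\<lambda>x. c * g x)"
    and "\<And>t. t > 0 \<Longrightarrow> S (\<lambda>x. \<Sum>k\<le>n. t ^ k * f k x)" "k \<le> n"
  shows "S (f k)"
  using assms(3,4)
proof (induction n arbitrary: f k)
  case 0
  then show ?case using "0"(1)[of 1] by simp
next
  case (Suc n)
  have low: "S (f k)" if "k \<le> n" for k
  proof -
    define h where "h k x = (2 ^ k - 2 ^ Suc n) * f k x" for k x
    have "S (h k)"
    proof (rule Suc.IH[OF _ that])
      fix t :: real assume "t > 0"
      then have "S (\<lambda>x. (\<Sum>k\<le>Suc n. (2 * t) ^ k * f k x) + (- (2 ^ Suc n)) * (\<Sum>k\<le>Suc n. t ^ k * f k x))"
        by (intro add cmult Suc.prems) auto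
      also have "(\<lambda>x. (\<Sum>k\<le>Suc n. (2 * t) ^ k * f k x) + (- (2 ^ Suc n)) * (\<Sum>k\<le>Suc n. t ^ k * f k x))
        = (\<lambda>x. \<Sum>k\<le>n. t ^ k * h k x)"
        by (simp add: fun_eq_iff h_def sum_distrib_left algebra_simps power_mult_distrib sum_subtractf sum_negf)
      finally show "S (\<lambda>x. \<Sum>k\<le>n. t ^ k * h k x)" .
    qed
    moreover have "(2::real) ^ k \<noteq> 2 ^ Suc n" using that power_inject_exp[of "2::real" k "Suc n"] by simp
    then have "f k = (\<lambda>x. 1 / (2 ^ k - 2 ^ Suc n) * h k x)" by (simp add: fun_eq_iff h_def)
    ultimately show ?thesis using cmult by metis
  qed
  have part: "S (\<lambda>x. \<Sum>k\<le>j. f k x)" if "j \<le> n" for j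
    using that by (induction j) (auto intro!: add low simp: low)
  have "S (\<lambda>x. (\<Sum>k\<le>Suc n. 1 ^ k * f k x) + (-1) * (\<Sum>k\<le>n. f k x))"
    by (intro add cmult part Suc.prems) auto
  then have "S (f (Suc n))" by simp
  then show ?case using low Suc.prems(2) le_Suc_eq by auto
qed

text \<open>The series \<open>E\<close> with \<open>E (z^2) = sinh z / z + t cosh z\<close>. The
  type is general because \<open>t\<close> is first a real number and later an
  indeterminate.\<close>

definition sinh_cosh_fps :: "'a::field_char_0 \<Rightarrow> 'a fps" where
  "sinh_cosh_fps t = Abs_fps (\<lambda>r. 1 / fact (2 * r + 1) + t / fact (2 * r))"

lemma fps_compose_X_squared_nth:
  "(f oo fps_X\<^sup>2) $ n = (if even n then f $ (n div 2) else (0::'a::comm_ring_1))"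
proof -
  have "(f oo fps_X\<^sup>2) $ n = (\<Sum>i=0..n. f $ i * (if n = 2 * i then 1 else 0))"
    by (simp add: fps_compose_nth flip: power_mult)
  also have "\<dots> = (if even n then f $ (n div 2) else 0)"
  proof (cases "even n")
    case True
    then obtain k where "n = 2 * k" by blast
    then show ?thesis by (simp add: if_distrib cong: if_cong)
  next
    case False
    then show ?thesis by (auto intro!: sum.neutral)
  qed
  finally show ?thesis .
qed

text \<open>Averaging over the sign of \<open>a\<close> cancels the odd powers, and what remains is
  a series in \<open>(a X)^2\<close>.\<close>

lemma exp_quot_plus_exp_even_part:
  "fps_const (1/2) * (exp_quot_plus_exp t (- a) + exp_quot_plus_exp t a) = fps_scale (a\<^sup>2) (sinh_cosh_fps t) oo fps_X\<^sup>2"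
proof (rule fps_ext)
  fix n
  show "(fps_const (1/2) * (exp_quot_plus_exp t (- a) + exp_quot_plus_exp t a)) $ n =
    (fps_scale (a\<^sup>2) (sinh_cosh_fps t) oo fps_X\<^sup>2) $ n"
  proof (cases "even n")
    case True
    then obtain k where [simp]: "n = 2 * k" by blast
    have "(- a) ^ n = (a\<^sup>2) ^ k" "a ^ n = (a\<^sup>2) ^ k" by (simp_all add: power_mult)
    then show ?thesis
      by (simp add: fps_compose_X_squared_nth exp_quot_plus_exp_def fps_exp_quot_def fps_scale_nth
          sinh_cosh_fps_def distrib_left del: fact_Suc)
  next
    case False
    then show ?thesis
      by (simp add: fps_compose_X_squared_nth exp_quot_plus_exp_def fps_exp_quot_def power_minus_odd)
  qed
qed

lemma sum_tau_even:
  "(\<Sum>k\<le>n. fact n / (fact (n - k) * fact (2 * m + k)) * t ^ (n - k) * tau n (2 * m) k x) =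
     (\<Prod>j=1..n. fps_scale ((x j)\<^sup>2) (sinh_cosh_fps t)) $ m"
  unfolding sum_tau exp_quot_plus_exp_even_part
  by (subst fps_compose_prod_distrib[symmetric]) (simp_all add: fps_compose_X_squared_nth)

text \<open>The relation that characterises \<open>c_const\<close>, in a form that is linear in the
  pair \<open>(c, g)\<close>.\<close>

definition leading_coeff_in :: "nat \<Rightarrow> nat \<Rightarrow> real \<Rightarrow> ((nat \<Rightarrow> real) \<Rightarrow> real) \<Rightarrow> bool" where
  "leading_coeff_in n m c g \<longleftrightarrow>
     poly_fun_in {1..<m} (\<lambda>x i. elem_sym_sq n i x) (\<lambda>x. g x - c * elem_sym_sq n m x)"

lemma leading_coeff_in_add:
  assumes "leading_coeff_in n m c g" "leading_coeff_in n m d h"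
  shows "leading_coeff_in n m (c + d) (\<lambda>x. g x + h x)"
  using poly_fun_in_add[OF assms[unfolded leading_coeff_in_def]]
  by (simp add: leading_coeff_in_def algebra_simps)

lemma leading_coeff_in_cmult:
  assumes "leading_coeff_in n m c g"
  shows "leading_coeff_in n m (a * c) (\<lambda>x. a * g x)"
  using poly_fun_in_cmult[OF assms[unfolded leading_coeff_in_def], of a]
  by (simp add: leading_coeff_in_def algebra_simps)

lemma leading_coeff_in_0: "leading_coeff_in n m 0 (\<lambda>x. 0)"
  by (simp add: leading_coeff_in_def poly_fun_in_const)

lemma leading_coeff_in_sum:
  assumes "\<And>a. a \<in> A \<Longrightarrow> leading_coeff_in n m (c a) (g a)"
  shows "leading_coeff_in n m (\<Sum>a\<in>A. c a) (\<lambda>x. \<Sum>a\<in>A. g a x)"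
  using assms
  by (induction A rule: infinite_finite_induct)
     (auto intro: leading_coeff_in_add leading_coeff_in_0)

lemma leading_coeff_in_unique:
  assumes "leading_coeff_in n m c g" "leading_coeff_in n m d g" "1 \<le> m" "m \<le> n"
  shows "c = d"
proof -
  have "poly_fun_in {1..<m} (\<lambda>x i. elem_sym_sq n i x) (\<lambda>x. (d - c) * elem_sym_sq n m x)"
    using poly_fun_in_diff[OF assms(1,2)[unfolded leading_coeff_in_def]]
    by (simp add: algebra_simps)
  from elem_sym_sq_independent[OF assms(3,4) this] show ?thesis by simp
qed

text \<open>The constant term of \<open>sinh_cosh_fps t\<close> is \<open>1 + t\<close>, which is
  nonzero for \<open>t > 0\<close>.\<close>

lemma leading_coeff_sum_tau:
  assumes "t > 0" "m > 0"
  shows "leading_coeff_in n m ((1 + t) ^ n * (-1) ^ (m - 1) * fps_log_deriv (sinh_cosh_fps t) $ m)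
    (\<lambda>x. \<Sum>k\<le>n. fact n / (fact (n - k) * fact (2 * m + k)) * t ^ (n - k) * tau n (2 * m) k x)"
  using prod_fps_scale_leading_coeff[of "sinh_cosh_fps t" m n] assms
  unfolding leading_coeff_in_def sum_tau_even by (simp add: sinh_cosh_fps_def)

text \<open>The weighted sum over \<open>k\<close> has a leading coefficient for every
  \<open>t > 0\<close>, hence so does the coefficient of each power of \<open>t\<close>. The index
  is reversed so that \<open>f k\<close> accompanies \<open>t ^ k\<close>.\<close>

lemma leading_coeff_tau_exists:
  assumes "m > 0" "k \<le> n"
  shows "\<exists>c. leading_coeff_in n m c (tau n (2 * m) k)"
proof -
  define f where "f k x = fact n / (fact k * fact (2 * m + (n - k))) * tau n (2 * m) (n - k) x" for k x
  let ?S = "\<lambda>g. \<exists>c. leading_coeff_in n m c g"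
  have "?S (f (n - k))"
  proof (rule coeff_closed_of_poly_closed[where S = ?S and n = n])
    fix t :: real assume t: "t > 0"
    have "(\<lambda>x. \<Sum>k\<le>n. t ^ k * f k x) = (\<lambda>x. \<Sum>k\<le>n. fact n / (fact (n - k) * fact (2 * m + k)) * t ^ (n - k) * tau n (2 * m) k x)"
      by (intro ext sum.reindex_bij_witness[of _ "\<lambda>k. n - k" "\<lambda>k. n - k"]) (auto simp: f_def)
    then show "?S (\<lambda>x. \<Sum>k\<le>n. t ^ k * f k x)"
      using leading_coeff_sum_tau[OF t \<open>m > 0\<close>] by auto
  qed (blast intro: leading_coeff_in_add leading_coeff_in_cmult | simp)+
  then obtain c where "leading_coeff_in n m c (f (n - k))" by blast
  from leading_coeff_in_cmult[OF this, of "fact (n - k) * fact (2 * m + k) / fact n"]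
  show ?thesis using assms by (auto simp: f_def)
qed

lemma leading_coeff_c_const:
  assumes "1 \<le> m" "m \<le> n" "k \<le> n"
  shows "leading_coeff_in n m (c_const n m k) (tau n (2 * m) k)"
proof -
  have eq: "(\<exists>P. mpoly_vars P \<subseteq> {1..<m} \<and> (\<forall>x. tau n (2 * m) k x =
      c * elem_sym_sq n m x + mpoly_eval P (\<lambda>i. elem_sym_sq n i x)))
    \<longleftrightarrow> leading_coeff_in n m c (tau n (2 * m) k)" for c
    unfolding leading_coeff_in_def poly_fun_in_def by (simp add: algebra_simps)
  have "m > 0" using assms by simp
  then obtain c where c: "leading_coeff_in n m c (tau n (2 * m) k)"
    using leading_coeff_tau_exists assms by blast
  show ?thesis unfolding c_const_def eq
    by (rule theI[where a = c and P = "\<lambda>c. leading_coeff_in n m c (tau n (2 * m) k)"])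
       (rule c, erule leading_coeff_in_unique[OF _ c assms(1,2)])
qed

text \<open>The leading coefficient of the same sum is found twice, by linearity from the
  \<open>c_const\<close> and from the product formula. Uniqueness equates the two.\<close>

lemma poly_G_poly:
  assumes "1 \<le> m" "m \<le> n" "t > 0"
  shows "poly (G_poly n m) t = (1 + t) ^ n * (-1) ^ (m - 1) * fps_log_deriv (sinh_cosh_fps t) $ m"
proof -
  have "leading_coeff_in n m (\<Sum>k\<le>n. fact n / (fact (n - k) * fact (2 * m + k)) * t ^ (n - k) * c_const n m k)
    (\<lambda>x. \<Sum>k\<le>n. fact n / (fact (n - k) * fact (2 * m + k)) * t ^ (n - k) * tau n (2 * m) k x)"
    by (intro leading_coeff_in_sum leading_coeff_in_cmult leading_coeff_c_const) (use assms in auto)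
  moreover have "poly (G_poly n m) t = (\<Sum>k\<le>n. fact n / (fact (n - k) * fact (2 * m + k)) * t ^ (n - k) * c_const n m k)"
    by (simp add: G_poly_def poly_sum poly_monom atMost_atLeast0 mult_ac)
  ultimately show ?thesis
    using leading_coeff_in_unique[OF _ leading_coeff_sum_tau] assms by simp
qed

section \<open>From values at positive \<open>t\<close> to identities of polynomials\<close>

lemma poly_eqI_pos:
  fixes p q :: "real poly"
  assumes "\<And>t. t > 0 \<Longrightarrow> poly p t = poly q t"
  shows "p = q"
proof (rule ccontr)
  assume "p \<noteq> q"
  then have "finite {t. poly (p - q) t = 0}" by (intro poly_roots_finite) simp
  moreover have "{0<..} \<subseteq> {t. poly (p - q) t = 0}" using assms by auto
  ultimately have "finite {0::real<..}" by (rule finite_subset[rotated])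
  then show False using infinite_Ioi[of "0::real"] by simp
qed

text \<open>In \<open>poly_G_poly\<close> the number \<open>n\<close> enters only through
  \<open>(1 + t) ^ n\<close>.\<close>

lemma G_poly_factor:
  assumes "1 \<le> m" "m \<le> n"
  shows "G_poly n m = [:1, 1:] ^ (n - m) * G_poly m m"
proof (rule poly_eqI_pos)
  fix t :: real assume "t > 0"
  then show "poly (G_poly n m) t = poly ([:1, 1:] ^ (n - m) * G_poly m m) t"
    using assms by (simp add: poly_G_poly flip: power_add mult.assoc)
qed

lemma fps_X_deriv_nth: "(fps_X * fps_deriv f) $ m = of_nat m * f $ m"
  by (cases m) simp_all

text \<open>This is coefficient \<open>m\<close> of \<open>E * L = X * E'\<close> for the
  logarithmic derivative \<open>L\<close>, multiplied by \<open>(1 + t) ^ m\<close>. With the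
  denominators cleared it is an identity of polynomials and can be carried over to the fraction
  field. The sum stops before \<open>i = m\<close> because \<open>L\<close> has constant term
  zero.\<close>

lemma G_poly_recurrence:
  "(\<Sum>i<m. [:1 / fact (2 * i + 1), 1 / fact (2 * i):] * [:1, 1:] ^ i * ((-1) ^ (m - i - 1) * G_poly (m - i) (m - i)))
    = of_nat m * [:1 / fact (2 * m + 1), 1 / fact (2 * m):] * [:1, 1:] ^ m"
proof (rule poly_eqI_pos)
  fix t :: real assume t: "t > 0"
  let ?E = "sinh_cosh_fps t"
  have E0: "?E $ 0 \<noteq> 0" using t by (simp add: sinh_cosh_fps_def)
  have "(\<Sum>i\<le>m. ?E $ i * fps_log_deriv ?E $ (m - i)) = real m * ?E $ m"
    using arg_cong[OF fps_log_deriv_mult[OF E0], of "\<lambda>g. g $ m"]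
    by (simp only: fps_X_deriv_nth fps_mult_nth[of ?E] atMost_atLeast0)
  then have "(\<Sum>i<m. ?E $ i * fps_log_deriv ?E $ (m - i)) = real m * ?E $ m"
    by (simp add: fps_log_deriv_nth_0[OF E0] flip: lessThan_Suc_atMost)
  then have "(1 + t) ^ m * (\<Sum>i<m. ?E $ i * fps_log_deriv ?E $ (m - i)) = real m * ?E $ m * (1 + t) ^ m"
    by simp
  also have "(1 + t) ^ m * (\<Sum>i<m. ?E $ i * fps_log_deriv ?E $ (m - i)) =
    (\<Sum>i<m. ?E $ i * (1 + t) ^ i * ((-1) ^ (m - i - 1) * poly (G_poly (m - i) (m - i)) t))"
    unfolding sum_distrib_left
  proof (intro sum.cong refl)
    fix i assume "i \<in> {..<m}"
    then have "(1 + t) ^ m = (1 + t) ^ i * (1 + t) ^ (m - i)" "1 \<le> m - i"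
      by (auto simp flip: power_add)
    then show "(1 + t) ^ m * (?E $ i * fps_log_deriv ?E $ (m - i)) =
      ?E $ i * (1 + t) ^ i * ((-1) ^ (m - i - 1) * poly (G_poly (m - i) (m - i)) t)"
      using t by (simp add: poly_G_poly mult_ac flip: power_add)
  qed
  finally show "poly (\<Sum>i<m. [:1 / fact (2 * i + 1), 1 / fact (2 * i):] * [:1, 1:] ^ i * ((-1) ^ (m - i - 1) * G_poly (m - i) (m - i))) t
    = poly (of_nat m * [:1 / fact (2 * m + 1), 1 / fact (2 * m):] * [:1, 1:] ^ m) t"
    by (simp add: poly_sum sinh_cosh_fps_def del: mult_pCons_left mult_pCons_right)
qed

section \<open>The generating series\<close>

lemma to_fract_of_nat: "to_fract (of_nat n) = of_nat n"
  by (induction n) simp_all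

lemma to_fract_power: "to_fract (p ^ n) = to_fract p ^ n"
  by (induction n) simp_all

lemma to_fract_inverse_fact: "to_fract [:1 / fact k :: real:] = 1 / fact k"
proof -
  have "to_fract [:1 / fact k :: real:] * fact k = to_fract ([:1 / fact k:] * of_nat (fact k))"
    by (simp add: to_fract_of_nat del: mult_pCons_left of_nat_fact) (simp only: of_nat_fact)
  also have "[:1 / fact k :: real:] * of_nat (fact k) = 1"
    by (simp only: of_nat_poly) (simp add: pCons_one del: of_nat_fact, simp add: pCons_one)
  finally show ?thesis by (simp add: field_simps)
qed

lemma fps_sinh_nth: "fps_sinh $ n = (if odd n then 1 / fact n else 0)"
  by (simp add: fps_sinh_def fps_divide_unit inverse_fps_numeral)

lemma fps_cosh_nth: "fps_cosh $ n = (if even n then 1 / fact n else 0)"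
  by (simp add: fps_cosh_def fps_divide_unit inverse_fps_numeral)

lemma fps_deriv_sinh: "fps_deriv fps_sinh = fps_cosh"
  by (rule fps_ext) (simp add: fps_sinh_nth fps_cosh_nth field_simps del: of_nat_Suc)

lemma fps_deriv_cosh: "fps_deriv fps_cosh = fps_sinh"
  by (rule fps_ext) (simp add: fps_sinh_nth fps_cosh_nth field_simps del: of_nat_Suc)

lemma fps_X_coth_mult_sinh: "fps_X_coth * fps_sinh = fps_X * (fps_cosh :: 'a::field_char_0 fps)"
proof -
  have s: "(fps_sinh :: 'a fps) = fps_X * fps_shift 1 fps_sinh"
    by (rule fps_ext) (simp add: fps_sinh_nth)
  let ?u = "fps_shift 1 fps_sinh :: 'a fps"
  have "fps_X * fps_cosh = fps_sinh * (inverse ?u * (fps_cosh :: 'a fps))"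
    by (subst s) (simp add: fps_sinh_nth inverse_mult_eq_1' mult_ac)
  then have "fps_sinh dvd fps_X * (fps_cosh :: 'a fps)" by (rule dvdI)
  then show ?thesis unfolding fps_X_coth_def by (rule dvd_div_mult_self)
qed

lemma fps_X_coth_nth_0: "fps_X_coth $ 0 = (1 :: 'a::field_char_0)"
  using arg_cong[OF fps_X_coth_mult_sinh[where 'a = 'a], of "\<lambda>f. f $ 1"]
  by (simp add: fps_mult_nth fps_sinh_nth fps_cosh_nth)

lemma sinh_cosh_fps_compose_X_squared:
  "fps_X * (sinh_cosh_fps t oo fps_X\<^sup>2) = fps_sinh + fps_const t * fps_X * fps_cosh"
proof (rule fps_ext)
  fix n
  show "(fps_X * (sinh_cosh_fps t oo fps_X\<^sup>2)) $ n = (fps_sinh + fps_const t * fps_X * fps_cosh) $ n"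
    by (cases n) (auto simp: fps_compose_X_squared_nth sinh_cosh_fps_def fps_sinh_nth fps_cosh_nth
      mult.assoc simp del: fact_Suc elim!: evenE)
qed

text \<open>With \<open>F (z) = E (z^2)\<close> the hypothesis gives
  \<open>B (z^2) = z F' / (2 F)\<close>. Since \<open>z F = sinh z + t z cosh z\<close>, cancelling
  \<open>sinh z\<close> leaves an expression in \<open>z coth z\<close>. The constant term
  \<open>2 * (t + 1)\<close> keeps the denominator nonzero.\<close>

lemma log_deriv_sinh_cosh_compose:
  assumes "sinh_cosh_fps t * B = fps_X * fps_deriv (sinh_cosh_fps t)" "t + 1 \<noteq> 0"
  shows "B oo fps_X\<^sup>2 = (fps_X_coth + fps_const t * fps_X\<^sup>2 - 1) / (2 * (fps_const t * fps_X_coth + 1))"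
proof -
  let ?E = "sinh_cosh_fps t oo fps_X\<^sup>2" and ?B = "B oo fps_X\<^sup>2"
  let ?s = "fps_sinh" and ?c = "fps_cosh" and ?t = "fps_const t" and ?C = "fps_X_coth :: 'a fps"
  \<comment> \<open>The Euler operator doubles under the substitution of \<open>X^2\<close>; this is
    the \<open>2\<close> in the final denominator.\<close>
  have "fps_X * fps_deriv ?E = 2 * ((fps_X * fps_deriv (sinh_cosh_fps t)) oo fps_X\<^sup>2)"
  proof (rule fps_ext)
    fix n
    show "(fps_X * fps_deriv ?E) $ n = (2 * ((fps_X * fps_deriv (sinh_cosh_fps t)) oo fps_X\<^sup>2)) $ n"
      unfolding fps_X_deriv_nth numeral_fps_const fps_mult_left_const_nth fps_compose_X_squared_nth
      by (auto elim!: evenE)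
  qed
  also have "\<dots> = 2 * (?E * ?B)"
    unfolding assms(1)[symmetric] by (subst fps_compose_mult_distrib) simp_all
  finally have XE': "fps_X * fps_deriv ?E = 2 * (?E * ?B)" .
  have "fps_deriv (fps_X * ?E) = fps_deriv (?s + ?t * fps_X * ?c)"
    by (simp only: sinh_cosh_fps_compose_X_squared)
  then have "?E + fps_X * fps_deriv ?E = ?c + ?t * ?c + ?t * fps_X * ?s"
    by (simp add: fps_deriv_sinh fps_deriv_cosh algebra_simps)
  then have "fps_X * ?E + fps_X * (2 * (?E * ?B)) = fps_X * (?c + ?t * ?c + ?t * fps_X * ?s)"
    unfolding XE' distrib_left[symmetric] by simp
  then have "2 * ?B * (?s + ?t * (fps_X * ?c)) = fps_X * ?c + ?t * fps_X\<^sup>2 * ?s - ?s"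
    using sinh_cosh_fps_compose_X_squared[of t] by algebra
  then have "(?B * (2 * (?t * ?C + 1))) * ?s = (?C + ?t * fps_X\<^sup>2 - 1) * ?s"
    unfolding fps_X_coth_mult_sinh[symmetric] by (simp add: algebra_simps)
  moreover have "?s \<noteq> (0 :: 'a fps)"
  proof
    assume "?s = (0 :: 'a fps)"
    then have "?s $ 1 = (0 :: 'a)" by simp
    then show False by (simp add: fps_sinh_nth)
  qed
  ultimately have *: "?B * (2 * (?t * ?C + 1)) = ?C + ?t * fps_X\<^sup>2 - 1"
    by simp
  have "2 * (?t * ?C + 1) \<noteq> 0"
  proof
    assume "2 * (?t * ?C + 1) = 0"
    moreover have "(2 * (?t * ?C + 1)) $ 0 = 2 * (t + 1)"
      by (simp add: fps_X_coth_nth_0 distrib_left)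
    ultimately have "2 * (t + 1) = 0" by (metis fps_zero_nth)
    then show False using assms(2) unfolding mult_eq_0_iff by simp
  qed
  then show ?thesis unfolding *[symmetric] by simp
qed

text \<open>Convergence is coefficientwise: coefficient \<open>n\<close> of the partial sums is
  constant once \<open>N > n\<close>. The series starts at the first power, hence the condition on
  \<open>f $ 0\<close>.\<close>

lemma fps_sums_compose_X_squared:
  fixes f :: "'a::comm_ring_1 fps"
  assumes "f $ 0 = 0"
  shows "(\<lambda>i. fps_const (f $ (i + 1)) * (fps_X\<^sup>2) ^ (i + 1)) sums (f oo fps_X\<^sup>2)"
  unfolding sums_def
proof (rule tendsto_fpsI)
  fix n
  have "(\<Sum>i<N. fps_const (f $ (i + 1)) * (fps_X\<^sup>2) ^ (i + 1)) $ n = (f oo fps_X\<^sup>2) $ n" if "N > n" for N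
  proof -
    have "(\<Sum>i<N. fps_const (f $ (i + 1)) * (fps_X\<^sup>2) ^ (i + 1)) $ n
      = (\<Sum>i<N. if n = 2 * Suc i then f $ Suc i else 0)"
      by (auto simp: fps_sum_nth simp flip: power_mult power_Suc intro!: sum.cong)
    also have "\<dots> = (f oo fps_X\<^sup>2) $ n"
    proof (cases "even n \<and> n > 0")
      case True
      then obtain k where k: "n = 2 * Suc k" by (metis evenE gr0_implies_Suc mult_0_right not_gr0)
      then show ?thesis using that by (simp add: fps_compose_X_squared_nth)
    next
      case False
      then show ?thesis using assms by (auto simp: fps_compose_X_squared_nth intro!: sum.neutral)
    qed
    finally show ?thesis .
  qed
  then show "\<forall>\<^sub>F N in sequentially. (\<Sum>i<N. fps_const (f $ (i + 1)) * (fps_X\<^sup>2) ^ (i + 1)) $ n = (f oo fps_X\<^sup>2) $ n"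
    unfolding eventually_sequentially by (intro exI[of _ "Suc n"]) auto
qed

text \<open>The left side of the generating identity as a series in \<open>y = z^2\<close>. The
  value \<open>0\<close> at \<open>m = 0\<close> matches the constant term of a logarithmic
  derivative.\<close>

definition G_log_deriv :: "real poly fract fps" where
  "G_log_deriv = Abs_fps (\<lambda>m. if m = 0 then 0 else
     (-1) ^ (m - 1) * to_fract (G_poly m m) / (to_fract [:0, 1:] + 1) ^ m)"

lemma to_fract_t_plus_1: "to_fract [:0, 1 :: real:] + 1 = to_fract [:1, 1:]"
  by (simp flip: to_fract_1 to_fract_add add: one_pCons)

text \<open>The polynomial recurrence is mapped to the fraction field, where
  \<open>(t + 1) ^ m\<close> can be divided out again.\<close>

lemma sinh_cosh_mult_G_log_deriv:
  fixes t :: "real poly fract"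
  defines "t \<equiv> to_fract [:0, 1:]"
  shows "sinh_cosh_fps t * G_log_deriv = fps_X * fps_deriv (sinh_cosh_fps t)"
proof (rule fps_ext)
  fix m
  let ?E = "sinh_cosh_fps t"
  have t1: "t + 1 = to_fract [:1, 1:]" unfolding t_def by (rule to_fract_t_plus_1)
  then have t1_nz: "t + 1 \<noteq> 0" by simp
  have E: "to_fract [:1 / fact (2 * i + 1), 1 / fact (2 * i):] = ?E $ i" for i
  proof -
    have "[:1 / fact (2 * i + 1), 1 / fact (2 * i) :: real:] =
        [:1 / fact (2 * i + 1):] + [:0, 1:] * [:1 / fact (2 * i):]"
      by (simp del: fact_Suc)
    then show ?thesis
      by (simp only: to_fract_add to_fract_mult to_fract_inverse_fact) (simp add: sinh_cosh_fps_def t_def)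
  qed
  have "(\<Sum>i<m. ?E $ i * (t + 1) ^ i * ((-1) ^ (m - i - 1) * to_fract (G_poly (m - i) (m - i))))
    = of_nat m * ?E $ m * (t + 1) ^ m"
    using arg_cong[OF G_poly_recurrence[of m], of to_fract]
    by (simp only: to_fract_sum to_fract_mult to_fract_power to_fract_of_nat to_fract_uminus to_fract_1 E t1)
  also have "(\<Sum>i<m. ?E $ i * (t + 1) ^ i * ((-1) ^ (m - i - 1) * to_fract (G_poly (m - i) (m - i))))
    = (\<Sum>i<m. ?E $ i * G_log_deriv $ (m - i)) * (t + 1) ^ m"
    unfolding sum_distrib_right
  proof (intro sum.cong refl)
    fix i assume "i \<in> {..<m}"
    then have "(t + 1) ^ m = (t + 1) ^ i * (t + 1) ^ (m - i)" "m - i \<noteq> 0"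
      by (auto simp flip: power_add)
    then show "?E $ i * (t + 1) ^ i * ((-1) ^ (m - i - 1) * to_fract (G_poly (m - i) (m - i)))
      = ?E $ i * G_log_deriv $ (m - i) * (t + 1) ^ m"
      using t1_nz by (simp add: G_log_deriv_def t_def)
  qed
  finally have "(\<Sum>i<m. ?E $ i * G_log_deriv $ (m - i)) = of_nat m * ?E $ m"
    using t1_nz by simp
  then have "(\<Sum>i\<le>m. ?E $ i * G_log_deriv $ (m - i)) = of_nat m * ?E $ m"
    by (simp add: G_log_deriv_def flip: lessThan_Suc_atMost)
  then show "(?E * G_log_deriv) $ m = (fps_X * fps_deriv ?E) $ m"
    by (simp only: fps_X_deriv_nth fps_mult_nth[of ?E] atMost_atLeast0)
qed

text \<open>Here \<open>t\<close> is the indeterminate inside the field of rational functions, where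
  \<open>t + 1\<close> is invertible.\<close>

theorem theorem1p3:
  fixes t :: "real poly fract"
  defines "t \<equiv> to_fract [:0, 1:]"
  shows "(\<forall>n m. 1 \<le> m \<and> m \<le> n \<longrightarrow> G_poly n m = [:1, 1:] ^ (n - m) * G_poly m m)
    \<and> (\<lambda>i. let m = i + 1 in
          (-1) ^ (m - 1) * fps_const (to_fract (G_poly m m)) * (fps_X\<^sup>2 / fps_const (t + 1)) ^ m)
      sums ((fps_X_coth + fps_const t * fps_X\<^sup>2 - 1) / (2 * (fps_const t * fps_X_coth + 1)))"
proof
  show "\<forall>n m. 1 \<le> m \<and> m \<le> n \<longrightarrow> G_poly n m = [:1, 1:] ^ (n - m) * G_poly m m"
    using G_poly_factor by blast
  have t1: "t + 1 \<noteq> 0" by (simp add: t_def to_fract_t_plus_1)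
  \<comment> \<open>The sign and the power of \<open>1 / (t + 1)\<close> are absorbed into the
    coefficient, which leaves a series in powers of \<open>X^2\<close>.\<close>
  have "(\<lambda>i. let m = i + 1 in
          (-1) ^ (m - 1) * fps_const (to_fract (G_poly m m)) * (fps_X\<^sup>2 / fps_const (t + 1)) ^ m)
    = (\<lambda>i. fps_const (G_log_deriv $ (i + 1)) * (fps_X\<^sup>2) ^ (i + 1))"
  proof
    fix i
    have "fps_X\<^sup>2 / fps_const (t + 1) = fps_const (1 / (t + 1)) * fps_X\<^sup>2"
      using t1 by (simp add: fps_divide_unit fps_const_inverse inverse_eq_divide mult.commute)
    moreover have "(-1) ^ i * fps_const a * (fps_const b * Y) ^ Suc i =
        fps_const ((-1) ^ i * a * b ^ Suc i) * Y ^ Suc i" for a b :: "real poly fract" and Y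
      by (simp add: power_mult_distrib mult.assoc flip: fps_const_mult fps_const_power del: power_Suc)
    ultimately show "(let m = i + 1 in
          (-1) ^ (m - 1) * fps_const (to_fract (G_poly m m)) * (fps_X\<^sup>2 / fps_const (t + 1)) ^ m)
      = fps_const (G_log_deriv $ (i + 1)) * (fps_X\<^sup>2) ^ (i + 1)"
      by (simp add: Let_def G_log_deriv_def t_def[symmetric] power_one_over del: power_Suc)
  qed
  moreover have "G_log_deriv $ 0 = 0" by (simp add: G_log_deriv_def)
  ultimately show "(\<lambda>i. let m = i + 1 in
          (-1) ^ (m - 1) * fps_const (to_fract (G_poly m m)) * (fps_X\<^sup>2 / fps_const (t + 1)) ^ m)
      sums ((fps_X_coth + fps_const t * fps_X\<^sup>2 - 1) / (2 * (fps_const t * fps_X_coth + 1)))"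
    using fps_sums_compose_X_squared[of G_log_deriv]
      log_deriv_sinh_cosh_compose[OF sinh_cosh_mult_G_log_deriv[folded t_def] t1] by simp
qed

end
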